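(* Let $\mathcal V$ be a multivector field on $X$, assume $X$ is invariant, and let $\mathcal M=\{M_r\mid r\in\mathbb P\}$ be a Morse decomposition of $X$. Define $m_k(\mathcal M):=\sum_{r\in\mathbb P}\beta_k(M_r)$. Then for every integer $k\ge0$: (i) (strong Morse inequalities) $m_k(\mathcal M)-m_{k-1}(\mathcal M)+\dots\pm m_0(\mathcal M)\ \ge\ \beta_k(X)-\beta_{k-1}(X)+\dots\pm\beta_0(X)$; (ii) (weak Morse inequalities) $m_k(\mathcal M)\ge\beta_k(X)$.
   Context: $X$ is a finite $T_0$ topological space. For $A\subset X$, $\operatorname{cl}A$ is its closure and $\operatorname{mo}A:=\operatorname{cl}A\setminus A$. $A$ is locally closed if it is the intersection of an open and a closed subset of $X$. $H$ denotes relative singular homology. A multivector is a nonempty locally closed subset of $X$; a multivector field $\mathcal V$ on $X$ is a partition of $X$ into multivectors. For $x\in X$, $[x]$ denotes the element of $\mathcal V$ containing $x$. A multivector $V$ is critical if $H(\operatorname{cl}V,\operatorname{mo}V)\neq0$, regular otherwise. $A\subset X$ is $\mathcal V$-compatible if for every $x\in X$ either $[x]\cap A=\emptyset$ or $[x]\subset A$. Put $\Pi_{\mathcal V}(x):=[x]\cup\operatorname{cl}\{x\}$ and $\Pi_{\mathcal V}(A):=\bigcup_{x\in A}\Pi_{\mathcal V}(x)$. A $\mathbb Z$-interval is $\mathbb Z\cap I$ for a real interval $I$. A solution in $A\subset X$ is a map $\varphi:D\to A$ on a $\mathbb Z$-interval $D$ with $\varphi(i+1)\in\Pi_{\mathcal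 V}(\varphi(i))$ whenever $i,i+1\in D$; it is full if $D=\mathbb Z$, and a path if $D$ is bounded, its endpoints being $\varphi(\min D)$ and $\varphi(\max D)$. A full solution $\varphi$ is essential if for every $t\in\mathbb Z$ with $[\varphi(t)]$ regular, the set $\{s\in\mathbb Z:\varphi(s)\notin[\varphi(t)]\}$ is unbounded below and unbounded above. $\operatorname{Inv}A$ is the set of $x\in A$ such that there is an essential full solution $\varphi$ with image in $A$ and $\varphi(0)=x$; $A$ is invariant if $\operatorname{Inv}A=A$. A closed set $N$ isolates an invariant set $S\subset N$ if (a) every path in $N$ with both endpoints in $S$ has image contained in $S$, and (b) $\Pi_{\mathcal V}(S)\subset N$. An invariant set is an isolated invariant set if some closed set isolates it. For a full solution $\varphi$: $\operatorname{uim}^-\varphi:=\bigcap_{t\le0}\varphi((-\infty,t])$, $\operatorname{uim}^+\varphi:=\bigcap_{t\ge0}\varphi([t,\infty))$; the $\mathcal V$-hull $\langle A\rangle_{\mathcal V}$ is the intersection of all $\mathcal V$-compatible locally closed sets containing $A$; $\alpha(\varphi):=\langle\operatorname{uim}^-\varphi\rangle_{\mathcal V}$, $\omega(\varphi):=\langle\operatorname{uim}^+\varphi\rangle_{\mathcal V}$. For invariant $X$ and a finite poset $(\mathbb P,\le)$, a family $\mathcal M=\{M_p\mid p\in\mathbb P\}$ is a Morse decomposition of $X$ if (i) the $M_p$ are mutually disjoint isolated invariant subsets of $X$, and (ii) for every essential full solution $\varphi$ in $X$ either $\operatorname{im}\varphi\subset M_r$ for some $r$, or there exist $p<q$ with $\alpha(\varphi)\subset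 M_q$ and $\omega(\varphi)\subset M_p$. For a locally closed $A\subset X$, $\beta_k(A):=\operatorname{rank}H_k(\operatorname{cl}A,\operatorname{mo}A)$; in particular $\beta_k(X)=\operatorname{rank}H_k(X)$. *)

theory Defs
  imports "HOL-Homology.Homology" "HOL-Analysis.Analysis"
begin

definition zindep :: "('g, 'b) monoid_scheme \<Rightarrow> 'g set \<Rightarrow> bool" where
  "zindep G S \<longleftrightarrow> finite S \<and> S \<subseteq> carrier G \<and>
     (\<forall>c :: 'g \<Rightarrow> int. finprod G (\<lambda>x. pow G x (c x)) S = one G \<longrightarrow> (\<forall>x\<in>S. c x = 0))"

definition grank :: "('g, 'b) monoid_scheme \<Rightarrow> nat" where
  "grank G = Sup {card S | S. zindep G S}"

definition mo :: "'a topology \<Rightarrow> 'a set \<Rightarrow> 'a set" where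
  "mo T A = (T closure_of A) - A"

definition locally_closed_in :: "'a topology \<Rightarrow> 'a set \<Rightarrow> bool" where
  "locally_closed_in T A \<longleftrightarrow> (\<exists>U C. openin T U \<and> closedin T C \<and> A = U \<inter> C)"

definition multivector :: "'a topology \<Rightarrow> 'a set \<Rightarrow> bool" where
  "multivector T A \<longleftrightarrow> A \<noteq> {} \<and> locally_closed_in T A"

definition mvfield :: "'a topology \<Rightarrow> 'a set set \<Rightarrow> bool" where
  "mvfield T V \<longleftrightarrow> (\<forall>A\<in>V. multivector T A) \<and> \<Union>V = topspace T \<and>
     (\<forall>A\<in>V. \<forall>B\<in>V. A \<noteq> B \<longrightarrow> A \<inter> B = {})"

definition cell :: "'a set set \<Rightarrow> 'a \<Rightarrow> 'a set" where
  "cell V x = (THE A. A \<in> V \<and> x \<in> A)"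

definition relhom :: "'a topology \<Rightarrow> 'a set \<Rightarrow> int \<Rightarrow> 'a chain set monoid" where
  "relhom T A k = relative_homology_group k (subtopology T (T closure_of A)) (mo T A)"

definition critical :: "'a topology \<Rightarrow> 'a set \<Rightarrow> bool" where
  "critical T A \<longleftrightarrow> (\<exists>k. \<not> trivial_group (relhom T A k))"

definition regular :: "'a topology \<Rightarrow> 'a set \<Rightarrow> bool" where
  "regular T A \<longleftrightarrow> \<not> critical T A"

definition compatible :: "'a topology \<Rightarrow> 'a set set \<Rightarrow> 'a set \<Rightarrow> bool" where
  "compatible T V A \<longleftrightarrow> (\<forall>x\<in>topspace T. cell V x \<inter> A = {} \<or> cell V x \<subseteq> A)"

definition Pi_V :: "'a topology \<Rightarrow> 'a set set \<Rightarrow> 'a \<Rightarrow> 'a set" where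
  "Pi_V T V x = cell V x \<union> T closure_of {x}"

definition full_solution :: "'a topology \<Rightarrow> 'a set set \<Rightarrow> 'a set \<Rightarrow> (int \<Rightarrow> 'a) \<Rightarrow> bool" where
  "full_solution T V A \<phi> \<longleftrightarrow> (\<forall>i. \<phi> i \<in> A) \<and> (\<forall>i. \<phi> (i + 1) \<in> Pi_V T V (\<phi> i))"

definition path_in :: "'a topology \<Rightarrow> 'a set set \<Rightarrow> 'a set \<Rightarrow> int \<Rightarrow> int \<Rightarrow> (int \<Rightarrow> 'a) \<Rightarrow> bool" where
  "path_in T V A a b \<phi> \<longleftrightarrow> a \<le> b \<and> (\<forall>i\<in>{a..b}. \<phi> i \<in> A) \<and>
     (\<forall>i. a \<le> i \<and> i + 1 \<le> b \<longrightarrow> \<phi> (i + 1) \<in> Pi_V T V (\<phi> i))"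

definition essential :: "'a topology \<Rightarrow> 'a set set \<Rightarrow> (int \<Rightarrow> 'a) \<Rightarrow> bool" where
  "essential T V \<phi> \<longleftrightarrow> (\<forall>t. regular T (cell V (\<phi> t)) \<longrightarrow>
     (\<forall>n. \<exists>s. s \<le> n \<and> \<phi> s \<notin> cell V (\<phi> t)) \<and>
     (\<forall>n. \<exists>s. s \<ge> n \<and> \<phi> s \<notin> cell V (\<phi> t)))"

definition Inv :: "'a topology \<Rightarrow> 'a set set \<Rightarrow> 'a set \<Rightarrow> 'a set" where
  "Inv T V A = {x \<in> A. \<exists>\<phi>. full_solution T V A \<phi> \<and> essential T V \<phi> \<and> \<phi> 0 = x}"

definition invariant :: "'a topology \<Rightarrow> 'a set set \<Rightarrow> 'a set \<Rightarrow> bool" where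
  "invariant T V A \<longleftrightarrow> Inv T V A = A"

definition isolates :: "'a topology \<Rightarrow> 'a set set \<Rightarrow> 'a set \<Rightarrow> 'a set \<Rightarrow> bool" where
  "isolates T V N S \<longleftrightarrow> closedin T N \<and> S \<subseteq> N \<and>
     (\<forall>a b \<phi>. path_in T V N a b \<phi> \<and> \<phi> a \<in> S \<and> \<phi> b \<in> S \<longrightarrow> \<phi> ` {a..b} \<subseteq> S) \<and>
     (\<Union>x\<in>S. Pi_V T V x) \<subseteq> N"

definition isolated_invariant :: "'a topology \<Rightarrow> 'a set set \<Rightarrow> 'a set \<Rightarrow> bool" where
  "isolated_invariant T V S \<longleftrightarrow> invariant T V S \<and> (\<exists>N. isolates T V N S)"

definition uim_minus :: "(int \<Rightarrow> 'a) \<Rightarrow> 'a set" where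
  "uim_minus \<phi> = (\<Inter>t\<in>{..0}. \<phi> ` {..t})"

definition uim_plus :: "(int \<Rightarrow> 'a) \<Rightarrow> 'a set" where
  "uim_plus \<phi> = (\<Inter>t\<in>{0..}. \<phi> ` {t..})"

definition vhull :: "'a topology \<Rightarrow> 'a set set \<Rightarrow> 'a set \<Rightarrow> 'a set" where
  "vhull T V A = \<Inter>{B. B \<subseteq> topspace T \<and> compatible T V B \<and> locally_closed_in T B \<and> A \<subseteq> B}"

definition alpha_lim :: "'a topology \<Rightarrow> 'a set set \<Rightarrow> (int \<Rightarrow> 'a) \<Rightarrow> 'a set" where
  "alpha_lim T V \<phi> = vhull T V (uim_minus \<phi>)"

definition omega_lim :: "'a topology \<Rightarrow> 'a set set \<Rightarrow> (int \<Rightarrow> 'a) \<Rightarrow> 'a set" where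
  "omega_lim T V \<phi> = vhull T V (uim_plus \<phi>)"

definition morse_decomposition ::
  "'a topology \<Rightarrow> 'a set set \<Rightarrow> 'p set \<Rightarrow> ('p \<Rightarrow> 'p \<Rightarrow> bool) \<Rightarrow> ('p \<Rightarrow> 'a set) \<Rightarrow> bool" where
  "morse_decomposition T V P leq M \<longleftrightarrow>
     finite P \<and>
     (\<forall>p\<in>P. leq p p) \<and>
     (\<forall>p\<in>P. \<forall>q\<in>P. leq p q \<and> leq q p \<longrightarrow> p = q) \<and>
     (\<forall>p\<in>P. \<forall>q\<in>P. \<forall>r\<in>P. leq p q \<and> leq q r \<longrightarrow> leq p r) \<and>
     (\<forall>p\<in>P. M p \<subseteq> topspace T \<and> isolated_invariant T V (M p)) \<and>
     (\<forall>p\<in>P. \<forall>q\<in>P. p \<noteq> q \<longrightarrow> M p \<inter> M q = {}) \<and>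
     (\<forall>\<phi>. full_solution T V (topspace T) \<phi> \<and> essential T V \<phi> \<longrightarrow>
        (\<exists>r\<in>P. range \<phi> \<subseteq> M r) \<or>
        (\<exists>p\<in>P. \<exists>q\<in>P. leq p q \<and> p \<noteq> q \<and> alpha_lim T V \<phi> \<subseteq> M q \<and> omega_lim T V \<phi> \<subseteq> M p))"

text \<open>beta_k(A) = rank H_k(cl A, mo A); for A = X this is rank H_k(X).\<close>
definition betti :: "'a topology \<Rightarrow> 'a set \<Rightarrow> nat \<Rightarrow> nat" where
  "betti T A k = grank (relhom T A (int k))"

definition morse_number :: "'a topology \<Rightarrow> 'p set \<Rightarrow> ('p \<Rightarrow> 'a set) \<Rightarrow> nat \<Rightarrow> nat" where
  "morse_number T P M k = (\<Sum>r\<in>P. betti T (M r) k)"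

end

theory Submission
  imports Defs
begin

text \<open>
  Order the Morse sets, together with the regular multivectors that lie in no Morse set, along the
  directed graph \<open>x \<rightarrow> y \<in> \<Pi>(x)\<close>. Splicing essential solutions shows that a path between Morse sets
  goes down in the poset and that a strongly connected component outside the Morse sets is a single
  regular multivector. Hence a nonempty set closed under \<open>\<Pi>\<close> always has a piece (a Morse set or a
  regular multivector) that nothing else in it reaches; peeling off such pieces filters \<open>X\<close> by closed
  sets, and the long exact sequences of consecutive pairs give the strong inequalities.

  The homology of a pair of closed sets depends only on their difference. The usual excision theorem
  does not apply, as closed sets of a finite space have no suitable neighbourhoods; instead
  excision for a closed cover \<open>A \<union> B\<close> is proved first on minimal open sets, where all the pieces are
  contractible or absent, and then glued by a Mayer--Vietoris induction over open sets.
\<close>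

section \<open>Ranks of abelian groups\<close>

text \<open>\<open>betti\<close> sees a set M only through its closure and its mouth, while exact
  sequences speak of a pair of closed sets (N, N') with N - N' = M. The bridge is that cl M and N'
  cover N and meet exactly in the mouth of M; this is why excision has to be available for two
  closed sets. Pieces must be removed from the top: what is left has to be closed under
  \<open>Pi_V\<close> again, for that is what makes it closed. Each removal errs in one direction
  only, by the rank of a connecting homomorphism, and regular multivectors contribute 0; so
  inequalities for the Morse sets alone remain. Homology groups may have torsion. All rank arguments
  therefore work up to nonzero integer multiples, inside the given groups. Finiteness of the ranks
  is a separate induction over the space, in which T0 supplies a closed point to remove; the same
  choice of point drives the excision argument.\<close>

lemma integer_system_nontrivial_solution:
  fixes a :: "'i \<Rightarrow> 'j \<Rightarrow> int"
  assumes "finite J" "finite I" "card J < card I"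
  shows "\<exists>c. (\<exists>i\<in>I. c i \<noteq> 0) \<and> (\<forall>j\<in>J. (\<Sum>i\<in>I. c i * a i j) = 0)"
  using assms
proof (induction J arbitrary: I a rule: finite_induct)
  case empty
  then obtain i where "i \<in> I" by fastforce
  then show ?case by (intro exI[of _ "\<lambda>_. 1"]) auto
next
  case (insert j J)
  show ?case
  proof (cases "\<forall>i\<in>I. a i j = 0")
    case True
    with insert.IH[of I a] insert.prems insert.hyps show ?thesis by auto
  next
    case False
    then obtain i0 where i0: "i0 \<in> I" "a i0 j \<noteq> 0" by blast
    define I' where "I' = I - {i0}"
    \<comment> \<open>Elimination of equation \<open>j\<close> with pivot \<open>a i0 j\<close>,
      cross-multiplied to avoid division; the coefficients of equation \<open>j\<close> itself
      become 0.\<close>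
    define b where "b i k = a i0 j * a i k - a i j * a i0 k" for i k
    have "finite I'" "card J < card I'"
      using insert.prems insert.hyps i0 by (auto simp: I'_def)
    with insert.IH[of I' b] obtain c where
      c: "\<exists>i\<in>I'. c i \<noteq> 0" "\<forall>k\<in>J. (\<Sum>i\<in>I'. c i * b i k) = 0" by blast
    \<comment> \<open>The solution of the reduced system scaled by the pivot; the value at
      \<open>i0\<close> is the one that makes equation \<open>j\<close> hold.\<close>
    define d where "d i = (if i = i0 then - (\<Sum>i\<in>I'. c i * a i j) else a i0 j * c i)" for i
    have "(\<Sum>i\<in>I. d i * a i k) = (\<Sum>i\<in>I'. c i * b i k)" for k
    proof -
      have "(\<Sum>i\<in>I. d i * a i k) = d i0 * a i0 k + (\<Sum>i\<in>I'. d i * a i k)"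
        using insert.prems i0 by (simp add: I'_def sum.remove)
      also have "(\<Sum>i\<in>I'. d i * a i k) = (\<Sum>i\<in>I'. a i0 j * c i * a i k)"
        by (intro sum.cong) (auto simp: d_def I'_def)
      also have "d i0 * a i0 k = - (\<Sum>i\<in>I'. c i * a i j * a i0 k)"
        by (simp add: d_def sum_distrib_right)
      finally show ?thesis
        by (simp add: b_def algebra_simps sum_subtractf)
    qed
    moreover have "(\<Sum>i\<in>I'. c i * b i j) = 0" by (simp add: b_def)
    moreover have "\<exists>i\<in>I. d i \<noteq> 0" using c(1) i0 by (auto simp: d_def I'_def)
    ultimately show ?thesis using c(2) by (intro exI[of _ d]) auto
  qed
qed

section \<open>Integer linear combinations in abelian groups\<close>

definition lincomb :: "('g, 'b) monoid_scheme \<Rightarrow> 'g set \<Rightarrow> ('g \<Rightarrow> int) \<Rightarrow> 'g" where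
  "lincomb G S c = finprod G (\<lambda>x. x [^]\<^bsub>G\<^esub> c x) S"

lemma zindep_lincomb:
  "zindep G S \<longleftrightarrow> finite S \<and> S \<subseteq> carrier G \<and> (\<forall>c. lincomb G S c = \<one>\<^bsub>G\<^esub> \<longrightarrow> (\<forall>x\<in>S. c x = 0))"
  by (simp add: zindep_def lincomb_def)

context comm_group
begin

lemma lincomb_closed [simp]: "S \<subseteq> carrier G \<Longrightarrow> lincomb G S c \<in> carrier G"
  unfolding lincomb_def by (intro finprod_closed) auto

lemma lincomb_insert:
  "\<lbrakk>finite S; x \<notin> S; insert x S \<subseteq> carrier G\<rbrakk>
    \<Longrightarrow> lincomb G (insert x S) c = x [^] c x \<otimes> lincomb G S c"
  unfolding lincomb_def by (subst finprod_insert) auto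

lemma lincomb_cong:
  "\<lbrakk>S \<subseteq> carrier G; \<And>x. x \<in> S \<Longrightarrow> c x = d x\<rbrakk> \<Longrightarrow> lincomb G S c = lincomb G S d"
  unfolding lincomb_def by (intro finprod_cong') auto

lemma lincomb_zero: "\<lbrakk>\<And>x. x \<in> S \<Longrightarrow> c x = 0\<rbrakk> \<Longrightarrow> lincomb G S c = \<one>"
  unfolding lincomb_def by (intro finprod_one_eqI) auto

lemma lincomb_add:
  "S \<subseteq> carrier G \<Longrightarrow> lincomb G S (\<lambda>x. c x + d x) = lincomb G S c \<otimes> lincomb G S d"
  unfolding lincomb_def
  by (subst finprod_multf [symmetric], blast, blast, rule finprod_cong') (auto simp: int_pow_mult subset_iff)

lemma lincomb_minus:
  assumes "S \<subseteq> carrier G"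
  shows "lincomb G S (\<lambda>x. - c x) = inv (lincomb G S c)"
proof -
  have "lincomb G S (\<lambda>x. - c x) \<otimes> lincomb G S c = \<one>"
    using lincomb_add[OF assms, of "\<lambda>x. - c x" c] lincomb_zero[of S "\<lambda>_. 0"] by simp
  then show ?thesis using assms by (intro inv_equality[symmetric]) auto
qed

lemma lincomb_cmul:
  assumes "S \<subseteq> carrier G"
  shows "lincomb G S (\<lambda>x. n * c x) = lincomb G S c [^] (n::int)"
proof (cases "finite S")
  case True
  then show ?thesis using assms
  proof (induction S)
    case empty
    then show ?case by (simp add: lincomb_def)
  next
    case (insert x S)
    then show ?case
      by (simp add: lincomb_insert int_pow_distrib int_pow_pow mult.commute)
  qed
qed (simp add: lincomb_def)

lemma lincomb_sum:
  assumes "finite U" "S \<subseteq> carrier G"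
  shows "finprod G (\<lambda>u. lincomb G S (f u)) U = lincomb G S (\<lambda>x. \<Sum>u\<in>U. f u x)"
  using assms(1)
proof (induction U)
  case empty
  then show ?case by (simp add: lincomb_zero)
next
  case (insert u U)
  then show ?case using assms(2) by (simp add: lincomb_add)
qed

lemma lincomb_Un:
  assumes "finite S" "finite T" "S \<inter> T = {}" "S \<subseteq> carrier G" "T \<subseteq> carrier G"
  shows "lincomb G (S \<union> T) c = lincomb G S c \<otimes> lincomb G T c"
  using assms unfolding lincomb_def by (intro finprod_Un_disjoint) auto

lemma lincomb_single:
  assumes "finite S" "S \<subseteq> carrier G" "u \<in> S"
  shows "lincomb G S (\<lambda>x. if x = u then n else 0) = u [^] (n::int)"
proof -
  have "lincomb G (insert u (S - {u})) (\<lambda>x. if x = u then n else 0) = u [^] n"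
    using assms lincomb_zero[of "S - {u}" "\<lambda>x. if x = u then n else 0"]
    by (subst lincomb_insert) auto
  then show ?thesis using assms by (simp add: insert_absorb)
qed

text \<open>The exchange bound, allowing torsion: only a nonzero multiple of each element of
  \<open>U\<close> has to lie in the span of \<open>B\<close>. If \<open>U\<close> were larger than
  \<open>B\<close>, the coefficient vectors would satisfy an integer relation, which becomes a
  relation in \<open>U\<close> once weighted with the multipliers.\<close>

lemma zindep_card_le:
  assumes U: "zindep G U" and B: "finite B" "B \<subseteq> carrier G"
    and dep: "\<And>u. u \<in> U \<Longrightarrow> \<exists>n c. n \<noteq> 0 \<and> u [^] (n::int) = lincomb G B c"
  shows "card U \<le> card B"
proof (rule ccontr)
  assume "\<not> card U \<le> card B"
  then have lt: "card B < card U" by simp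
  have U': "finite U" "U \<subseteq> carrier G" using U by (auto simp: zindep_def)
  obtain n a where na: "\<And>u. u \<in> U \<Longrightarrow> n u \<noteq> 0 \<and> u [^] (n u :: int) = lincomb G B (a u)"
    using dep by metis
  obtain c where c: "\<exists>u\<in>U. c u \<noteq> 0" "\<forall>b\<in>B. (\<Sum>u\<in>U. c u * a u b) = 0"
    using integer_system_nontrivial_solution[OF B(1) U'(1) lt, of a] by blast
  have "lincomb G U (\<lambda>u. c u * n u) = finprod G (\<lambda>u. lincomb G B (\<lambda>b. c u * a u b)) U"
    unfolding lincomb_def[of G U]
  proof (intro finprod_cong')
    fix u assume u: "u \<in> U"
    then have "u \<in> carrier G" using U' by auto
    then have "u [^] (c u * n u) = (u [^] n u) [^] c u" by (simp add: int_pow_pow mult.commute)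
    then show "u [^] (c u * n u) = lincomb G B (\<lambda>b. c u * a u b)"
      using na[OF u] B by (simp add: lincomb_cmul)
  qed (use B in auto)
  also have "\<dots> = lincomb G B (\<lambda>b. \<Sum>u\<in>U. c u * a u b)"
    by (rule lincomb_sum) (use U' B in auto)
  also have "\<dots> = \<one>" using c(2) by (intro lincomb_zero) auto
  finally have "\<forall>u\<in>U. c u * n u = 0" using U unfolding zindep_lincomb by blast
  then show False using c(1) na by auto
qed

end

text \<open>Independence is measured in the ambient group, so that kernels and images have a rank
  without being turned into groups of their own.\<close>

definition zrank :: "('g, 'b) monoid_scheme \<Rightarrow> 'g set \<Rightarrow> nat" where
  "zrank G K = Sup {card S | S. zindep G S \<and> S \<subseteq> K}"

text \<open>On \<open>nat\<close>, \<open>Sup\<close> of an unbounded set is a junk value, so every use of a rank needs this.\<close>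

definition finite_zrank :: "('g, 'b) monoid_scheme \<Rightarrow> 'g set \<Rightarrow> bool" where
  "finite_zrank G K \<longleftrightarrow> (\<exists>n. \<forall>S. zindep G S \<and> S \<subseteq> K \<longrightarrow> card S \<le> n)"

lemma grank_eq_zrank: "grank G = zrank G (carrier G)"
  unfolding grank_def zrank_def by (rule arg_cong[where f=Sup]) (auto simp: zindep_def)

lemma finite_zrank_mono: "finite_zrank G L \<Longrightarrow> K \<subseteq> L \<Longrightarrow> finite_zrank G K"
  unfolding finite_zrank_def by (meson subset_trans)

lemma zindep_empty [simp]: "zindep G {}"
  by (simp add: zindep_def)

lemma zrank_attained:
  assumes "finite_zrank G K"
  obtains S where "zindep G S" "S \<subseteq> K" "card S = zrank G K"
proof -
  let ?A = "{card S | S. zindep G S \<and> S \<subseteq> K}"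
  obtain n where "\<forall>S. zindep G S \<and> S \<subseteq> K \<longrightarrow> card S \<le> n"
    using assms unfolding finite_zrank_def by blast
  then have "?A \<subseteq> {..n}" by auto
  then have fin: "finite ?A" using finite_subset by blast
  moreover have "?A \<noteq> {}" by (auto intro: exI[of _ "{}"])
  ultimately have "Sup ?A \<in> ?A" unfolding Sup_nat_def by (metis (no_types, lifting) Max_in)
  then show thesis using that unfolding zrank_def by auto
qed

lemma card_le_zrank:
  assumes "finite_zrank G K" "zindep G S" "S \<subseteq> K"
  shows "card S \<le> zrank G K"
proof -
  let ?A = "{card S | S. zindep G S \<and> S \<subseteq> K}"
  obtain n where "\<forall>S. zindep G S \<and> S \<subseteq> K \<longrightarrow> card S \<le> n"
    using assms unfolding finite_zrank_def by blast
  then have "bdd_above ?A" by (auto simp: bdd_above_def)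
  moreover have "card S \<in> ?A" using assms by auto
  ultimately show ?thesis unfolding zrank_def by (simp add: cSup_upper)
qed

lemma zrank_eqI:
  assumes "zindep G S" "S \<subseteq> K" "card S = n" "\<And>S. zindep G S \<Longrightarrow> S \<subseteq> K \<Longrightarrow> card S \<le> n"
  shows "finite_zrank G K" "zrank G K = n"
proof -
  show fin: "finite_zrank G K" using assms unfolding finite_zrank_def by blast
  show "zrank G K = n"
    using card_le_zrank[OF fin assms(1,2)] zrank_attained[OF fin] assms(3,4)
    by (metis le_antisym)
qed

text \<open>A maximal independent set spans up to nonzero multiples: adjoining \<open>u\<close>
  creates a relation, and \<open>u\<close> must occur in it.\<close>

lemma zrank_maximal_spans:
  assumes "comm_group G" "finite_zrank G K" "K \<subseteq> carrier G"
    and S: "zindep G S" "S \<subseteq> K" "card S = zrank G K" and u: "u \<in> K"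
  shows "\<exists>n c. n \<noteq> 0 \<and> u [^]\<^bsub>G\<^esub> (n::int) = lincomb G S c"
proof -
  interpret comm_group G by fact
  have fS: "finite S" "S \<subseteq> carrier G" and uG: "u \<in> carrier G"
    using S assms by (auto simp: zindep_def)
  show ?thesis
  proof (cases "u \<in> S")
    case True
    then show ?thesis using lincomb_single[OF fS True, of 1]
      by (intro exI[of _ "1::int"] exI[of _ "\<lambda>x. if x = u then 1 else 0"]) simp
  next
    case False
    have "\<not> zindep G (insert u S)"
      using card_le_zrank[OF assms(2), of "insert u S"] S u fS False by auto
    then obtain c where c: "lincomb G (insert u S) c = \<one>\<^bsub>G\<^esub>" "\<exists>x\<in>insert u S. c x \<noteq> 0"
      using fS uG unfolding zindep_lincomb by auto
    then have eq: "u [^]\<^bsub>G\<^esub> c u \<otimes>\<^bsub>G\<^esub> lincomb G S c = \<one>\<^bsub>G\<^esub>"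
      using fS uG False by (simp add: lincomb_insert)
    have "c u \<noteq> 0"
    proof
      assume "c u = 0"
      with eq fS have "lincomb G S c = \<one>\<^bsub>G\<^esub>" by simp
      with S(1) c(2) \<open>c u = 0\<close> show False unfolding zindep_lincomb by auto
    qed
    moreover have "u [^]\<^bsub>G\<^esub> c u = lincomb G S (\<lambda>x. - c x)"
      using eq fS uG by (simp add: lincomb_minus inv_equality[symmetric])
    ultimately show ?thesis by blast
  qed
qed

section \<open>Homomorphisms and rank-nullity\<close>

lemma lincomb_hom:
  assumes "comm_group G" "comm_group H" "f \<in> hom G H" "S \<subseteq> carrier G" "finite S" "inj_on f S"
  shows "f (lincomb G S (\<lambda>x. c (f x))) = lincomb H (f ` S) c"
proof -
  interpret G: comm_group G by fact
  interpret H: comm_group H by fact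
  have im: "f x \<in> carrier H" if "x \<in> carrier G" for x using assms(3) that by (rule hom_in_carrier)
  show ?thesis using assms(5,4,6)
  proof (induction S)
    case empty
    show ?case using assms(3) by (simp add: lincomb_def hom_one)
  next
    case (insert x S)
    have "f (lincomb G (insert x S) (\<lambda>x. c (f x)))
      = f (x [^]\<^bsub>G\<^esub> c (f x)) \<otimes>\<^bsub>H\<^esub> f (lincomb G S (\<lambda>x. c (f x)))"
      using insert assms(3) by (simp add: G.lincomb_insert hom_mult)
    also have "f (x [^]\<^bsub>G\<^esub> c (f x)) = f x [^]\<^bsub>H\<^esub> c (f x)"
      using hom_int_pow[OF assms(3)] insert by simp
    also have "\<dots> \<otimes>\<^bsub>H\<^esub> f (lincomb G S (\<lambda>x. c (f x))) = lincomb H (insert (f x) (f ` S)) c"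
    proof (subst H.lincomb_insert)
      show "insert (f x) (f ` S) \<subseteq> carrier H" using insert im by auto
    qed (use insert in auto)
    finally show ?case by simp
  qed
qed

text \<open>Under \<open>f\<close> a relation loses its \<open>S\<close> part, so independence of
  the images kills the coefficients on \<open>T\<close>; what remains is a relation in
  \<open>S\<close>.\<close>

lemma zindep_kernel_Un_lift:
  assumes G: "comm_group G" and H: "comm_group H" and f: "f \<in> hom G H"
    and S: "zindep G S" "S \<subseteq> kernel G H f"
    and T: "finite T" "T \<subseteq> carrier G" "inj_on f T" "zindep H (f ` T)"
  shows "zindep G (S \<union> T)" "S \<inter> T = {}"
proof -
  interpret G: comm_group G by fact
  interpret H: comm_group H by fact
  have fS: "finite S" "S \<subseteq> carrier G" using S by (auto simp: zindep_def)
  have fker: "f (lincomb G S c) = \<one>\<^bsub>H\<^esub>" for c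
    using fS(1) S(2) 
  proof (induction S)
    case empty
    then show ?case using f by (simp add: lincomb_def hom_one)
  next
    case (insert x S)
    then have x: "x \<in> carrier G" "f x = \<one>\<^bsub>H\<^esub>" "S \<subseteq> carrier G" by (auto simp: kernel_def)
    then have "f (lincomb G (insert x S) c) = f (x [^]\<^bsub>G\<^esub> c x) \<otimes>\<^bsub>H\<^esub> f (lincomb G S c)"
      using insert f by (simp add: G.lincomb_insert hom_mult)
    also have "f (x [^]\<^bsub>G\<^esub> c x) = \<one>\<^bsub>H\<^esub>"
      using hom_int_pow[OF f _ G.is_group H.is_group] x by simp
    finally show ?case using insert by simp
  qed
  show disj: "S \<inter> T = {}"
  proof (rule ccontr)
    assume "S \<inter> T \<noteq> {}"
    then obtain t where t: "t \<in> T" "f t = \<one>\<^bsub>H\<^esub>" using S(2) by (auto simp: kernel_def)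
    have fT: "finite (f ` T)" "f ` T \<subseteq> carrier H" using T by (auto simp: zindep_def)
    have "lincomb H (f ` T) (\<lambda>x. if x = f t then 1 else 0) = \<one>\<^bsub>H\<^esub>"
      using H.lincomb_single[OF fT, of "f t" 1] t imageI[OF t(1), of f] by simp
    with T(4) t(1) show False unfolding zindep_lincomb by fastforce
  qed
  show "zindep G (S \<union> T)" unfolding zindep_lincomb
  proof (intro conjI allI impI)
    fix c assume c: "lincomb G (S \<union> T) c = \<one>\<^bsub>G\<^esub>"
    have eq: "lincomb G S c \<otimes>\<^bsub>G\<^esub> lincomb G T c = \<one>\<^bsub>G\<^esub>"
      using c G.lincomb_Un[OF fS(1) T(1) disj fS(2) T(2)] by simp
    \<comment> \<open>Moves the coefficients from \<open>T\<close> to its image, which is possible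
      because \<open>f\<close> is injective on \<open>T\<close>.\<close>
    define d where "d = (\<lambda>y. c (the_inv_into T f y))"
    have d: "c x = d (f x)" if "x \<in> T" for x
      using that T(3) by (simp add: d_def the_inv_into_f_f)
    have "lincomb G T c = lincomb G T (\<lambda>x. d (f x))"
      by (rule G.lincomb_cong) (use T d in auto)
    then have "f (lincomb G T c) = lincomb H (f ` T) d"
      using lincomb_hom[OF G H f T(2,1,3)] by simp
    moreover have "f (lincomb G S c \<otimes>\<^bsub>G\<^esub> lincomb G T c) = f (lincomb G S c) \<otimes>\<^bsub>H\<^esub> f (lincomb G T c)"
      using f fS T by (simp add: hom_mult)
    moreover have "f (lincomb G T c) \<in> carrier H" using f T hom_in_carrier by fastforce
    ultimately have "lincomb H (f ` T) d = \<one>\<^bsub>H\<^esub>"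
      using eq fker hom_one[OF f G.is_group H.is_group] by simp
    then have d0: "\<forall>x\<in>T. c x = 0" using T(4) d unfolding zindep_lincomb by auto
    then have "lincomb G T c = \<one>\<^bsub>G\<^esub>" by (intro G.lincomb_zero) auto
    with eq fS have "lincomb G S c = \<one>\<^bsub>G\<^esub>" by simp
    then have "\<forall>x\<in>S. c x = 0" using S(1) unfolding zindep_lincomb by auto
    with d0 show "\<forall>x\<in>S \<union> T. c x = 0" by auto
  qed (use fS T in auto)
qed

lemma image_zindep_lift:
  assumes "finite T" "T \<subseteq> f ` A"
  obtains T' where "T' \<subseteq> A" "finite T'" "inj_on f T'" "f ` T' = T"
  using assms by (metis subset_image_inj finite_image_iff)

lemma finite_zrank_image:
  assumes "comm_group G" "comm_group H" "f \<in> hom G H" "finite_zrank G (carrier G)"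
  shows "finite_zrank H (f ` carrier G)"
proof -
  have "card T \<le> zrank G (carrier G)" if T: "zindep H T" "T \<subseteq> f ` carrier G" for T
  proof -
    obtain T' where T': "T' \<subseteq> carrier G" "finite T'" "inj_on f T'" "f ` T' = T"
      using image_zindep_lift[of T f "carrier G"] T by (auto simp: zindep_def)
    have "zindep G ({} \<union> T')"
      by (rule zindep_kernel_Un_lift(1)[OF assms(1-3)]) (use T T' in auto)
    then have "card T' \<le> zrank G (carrier G)" using card_le_zrank[OF assms(4)] T' by simp
    then show ?thesis using card_image[OF T'(3)] T'(4) by simp
  qed
  then show ?thesis unfolding finite_zrank_def by blast
qed

text \<open>An independent set of maximal size in the kernel, together with lifts of one in the
  image, spans up to torsion. That \<open>G\<close> has finite rank is a conclusion here: this is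
  how finiteness passes through exact sequences.\<close>

lemma rank_nullity_aux:
  assumes G: "comm_group G" and H: "comm_group H" and f: "f \<in> hom G H"
    and fk: "finite_zrank G (kernel G H f)" and fi: "finite_zrank H (f ` carrier G)"
  shows "finite_zrank G (carrier G)"
    and "zrank G (carrier G) = zrank G (kernel G H f) + zrank H (f ` carrier G)"
proof -
  interpret G: comm_group G by fact
  interpret H: comm_group H by fact
  let ?K = "kernel G H f" and ?I = "f ` carrier G"
  have I: "?I \<subseteq> carrier H" using f by (auto simp: hom_def)
  have K: "?K \<subseteq> carrier G" by (auto simp: kernel_def)
  obtain S where S: "zindep G S" "S \<subseteq> ?K" "card S = zrank G ?K" using zrank_attained[OF fk] .
  obtain T where T: "zindep H T" "T \<subseteq> ?I" "card T = zrank H ?I" using zrank_attained[OF fi] .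
  obtain T' where T': "T' \<subseteq> carrier G" "finite T'" "inj_on f T'" "f ` T' = T"
    using image_zindep_lift[of T f "carrier G"] T by (auto simp: zindep_def)
  have ind: "zindep G (S \<union> T')" and disj: "S \<inter> T' = {}"
    using zindep_kernel_Un_lift[OF G H f S(1,2) T'(2,1,3)] T T' by auto
  have fS: "finite S" "S \<subseteq> carrier G" using S by (auto simp: zindep_def)
  have card: "card (S \<union> T') = zrank G ?K + zrank H ?I"
    using disj S T T' fS by (metis card_Un_disjoint card_image)
  have bound: "card U \<le> zrank G ?K + zrank H ?I" if U: "zindep G U" for U
    unfolding card[symmetric]
  proof (rule G.zindep_card_le[OF U])
    show "finite (S \<union> T')" "S \<union> T' \<subseteq> carrier G" using fS T' by auto
    fix u assume "u \<in> U"
    then have u: "u \<in> carrier G" using U by (auto simp: zindep_def)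
    then obtain n c where n: "n \<noteq> 0" and c: "f u [^]\<^bsub>H\<^esub> (n::int) = lincomb H T c"
      using zrank_maximal_spans[OF H fi I T, of "f u"] by auto
    let ?v = "lincomb G T' (\<lambda>x. c (f x))"
    have v: "?v \<in> carrier G" "f ?v = lincomb H T c"
      using lincomb_hom[OF G H f T'(1,2,3), of c] T' by auto
    \<comment> \<open>The lift is subtracted (in multiplicative notation) from a multiple of
      \<open>u\<close> with the same image. The difference lies in the kernel, where a further
      multiple is spanned by \<open>S\<close>.\<close>
    define w where "w = u [^]\<^bsub>G\<^esub> n \<otimes>\<^bsub>G\<^esub> inv\<^bsub>G\<^esub> ?v"
    have fv: "f ?v \<in> carrier H" using f v hom_in_carrier by fastforce
    have "f w = (f u [^]\<^bsub>H\<^esub> n) \<otimes>\<^bsub>H\<^esub> inv\<^bsub>H\<^esub> (f ?v)"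
      unfolding w_def using f u v hom_int_pow[OF f u G.is_group H.is_group, of n]
        group_hom.hom_inv[of G H f ?v]
      by (simp add: hom_mult group_hom_def group_hom_axioms_def)
    then have "f w = \<one>\<^bsub>H\<^esub>" using c v fv by simp
    moreover have wG: "w \<in> carrier G" unfolding w_def using u v by simp
    ultimately have "w \<in> ?K" by (simp add: kernel_def)
    then obtain m d where m: "m \<noteq> 0" and d: "w [^]\<^bsub>G\<^esub> (m::int) = lincomb G S d"
      using zrank_maximal_spans[OF G fk K S] by blast
    have "u [^]\<^bsub>G\<^esub> n = w \<otimes>\<^bsub>G\<^esub> ?v" unfolding w_def using u v by (simp add: G.m_assoc)
    then have "u [^]\<^bsub>G\<^esub> (n * m) = (w \<otimes>\<^bsub>G\<^esub> ?v) [^]\<^bsub>G\<^esub> m" using u by (simp add: G.int_pow_pow[symmetric])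
    also have "\<dots> = lincomb G S d \<otimes>\<^bsub>G\<^esub> lincomb G T' (\<lambda>x. m * c (f x))"
      using wG v d T' by (simp add: G.int_pow_distrib G.lincomb_cmul)
    also have "\<dots> = lincomb G (S \<union> T') (\<lambda>x. if x \<in> S then d x else m * c (f x))"
    proof -
      have "lincomb G S d = lincomb G S (\<lambda>x. if x \<in> S then d x else m * c (f x))"
        by (rule G.lincomb_cong) (use fS in auto)
      moreover have "lincomb G T' (\<lambda>x. m * c (f x)) = lincomb G T' (\<lambda>x. if x \<in> S then d x else m * c (f x))"
        by (rule G.lincomb_cong) (use T' disj in auto)
      ultimately show ?thesis using G.lincomb_Un[OF fS(1) T'(2) disj fS(2) T'(1)] by simp
    qed
    finally show "\<exists>n c. n \<noteq> 0 \<and> u [^]\<^bsub>G\<^esub> (n::int) = lincomb G (S \<union> T') c"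
      using n m by (intro exI conjI) auto
  qed
  have sub: "S \<union> T' \<subseteq> carrier G" using fS T' by simp
  show "finite_zrank G (carrier G)" "zrank G (carrier G) = zrank G ?K + zrank H ?I"
    by (rule zrank_eqI[OF ind sub card], erule bound)+
qed

lemma rank_nullity:
  assumes "comm_group G" "comm_group H" "f \<in> hom G H" "finite_zrank G (carrier G)"
  shows "grank G = zrank G (kernel G H f) + zrank H (f ` carrier G)"
proof -
  have "kernel G H f \<subseteq> carrier G" by (auto simp: kernel_def)
  then show ?thesis
    using rank_nullity_aux(2)[OF assms(1-3)] finite_zrank_mono[OF assms(4)] finite_zrank_image[OF assms]
    by (simp add: grank_eq_zrank)
qed

lemma finite_zrank_exact:
  assumes "comm_group F" "comm_group G" "comm_group H" "e \<in> hom F G" "f \<in> hom G H"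
    and "kernel G H f = e ` carrier F" "finite_zrank F (carrier F)" "finite_zrank H (carrier H)"
  shows "finite_zrank G (carrier G)"
proof (rule rank_nullity_aux(1)[OF assms(2,3,5)])
  show "finite_zrank G (kernel G H f)" using finite_zrank_image[OF assms(1,2,4,7)] assms(6) by simp
  have "f ` carrier G \<subseteq> carrier H" using assms(5) by (auto simp: hom_def)
  then show "finite_zrank H (f ` carrier G)" using finite_zrank_mono[OF assms(8)] by blast
qed

lemma zrank_trivial:
  fixes G :: "('g, 'b) monoid_scheme"
  assumes "comm_group G" "K \<subseteq> {\<one>\<^bsub>G\<^esub>}"
  shows "finite_zrank G K" "zrank G K = 0"
proof -
  interpret comm_group G by fact
  have "card S \<le> 0" if S: "zindep G S" "S \<subseteq> K" for S
  proof -
    have "card S \<le> card ({} :: 'g set)"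
    proof (rule zindep_card_le[OF S(1)])
      fix u assume "u \<in> S"
      then have "u = \<one>\<^bsub>G\<^esub>" using S assms by auto
      then show "\<exists>n c. n \<noteq> 0 \<and> u [^]\<^bsub>G\<^esub> (n::int) = lincomb G {} c"
        by (intro exI[of _ "1::int"] exI[of _ "\<lambda>_. 0"]) (simp add: lincomb_def)
    qed auto
    then show ?thesis by simp
  qed
  then show "finite_zrank G K" "zrank G K = 0"
    using zrank_eqI[of G "{}" K 0] by auto
qed

lemma grank_iso:
  assumes "comm_group G" "comm_group H" "f \<in> iso G H" "finite_zrank G (carrier G)"
  shows "finite_zrank H (carrier H)" "grank H = grank G"
proof -
  interpret G: comm_group G by fact
  interpret H: comm_group H by fact
  have f: "f \<in> hom G H" "f ` carrier G = carrier H" "inj_on f (carrier G)"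
    using assms(3) by (auto simp: iso_def bij_betw_def)
  have "kernel G H f \<subseteq> {\<one>\<^bsub>G\<^esub>}"
  proof
    fix x assume "x \<in> kernel G H f"
    then have "x \<in> carrier G" "f x = f \<one>\<^bsub>G\<^esub>"
      using hom_one[OF f(1) G.is_group H.is_group] by (simp_all add: kernel_def)
    then show "x \<in> {\<one>\<^bsub>G\<^esub>}" using inj_onD[OF f(3)] by simp
  qed
  then have "zrank G (kernel G H f) = 0" by (rule zrank_trivial(2)[OF assms(1)])
  then show "grank H = grank G"
    using rank_nullity[OF assms(1,2) f(1) assms(4)] by (simp add: grank_eq_zrank f(2))
  show "finite_zrank H (carrier H)"
    using finite_zrank_image[OF assms(1,2) f(1) assms(4)] by (simp add: f(2))
qed

section \<open>Finite spaces and small chains\<close>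

text \<open>In a finite space this is the smallest open neighbourhood of \<open>y\<close>. The
  intersection with \<open>topspace X\<close> keeps the value inside the space even if no open set
  contains \<open>y\<close>.\<close>

definition min_open :: "'a topology \<Rightarrow> 'a \<Rightarrow> 'a set" where
  "min_open X y = topspace X \<inter> \<Inter>{U. openin X U \<and> y \<in> U}"

lemma mem_min_open: "y \<in> topspace X \<Longrightarrow> y \<in> min_open X y"
  by (simp add: min_open_def)

lemma min_open_subset: "openin X U \<Longrightarrow> y \<in> U \<Longrightarrow> min_open X y \<subseteq> U"
  by (auto simp: min_open_def)

lemma openin_min_open: "finite (topspace X) \<Longrightarrow> openin X (min_open X y)"
proof -
  assume fin: "finite (topspace X)"
  have "{U. openin X U \<and> y \<in> U} \<subseteq> Pow (topspace X)" by (auto dest: openin_subset)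
  then have "finite {U. openin X U \<and> y \<in> U}" using fin finite_subset by blast
  then have "openin X (\<Inter>(insert (topspace X) {U. openin X U \<and> y \<in> U}))"
    by (intro openin_Inter) auto
  then show ?thesis by (simp add: min_open_def)
qed

lemma min_open_closed_disjoint:
  assumes "closedin X A" "y \<in> topspace X - A"
  shows "min_open X y \<inter> A = {}"
  using min_open_subset[of X "topspace X - A" y] assms by (auto simp: closedin_def)

text \<open>The homotopy is the identity for \<open>t < 1\<close> and jumps to \<open>y\<close> at
  \<open>t = 1\<close>. It is continuous because an open set other than the whole space misses
  \<open>y\<close>, so its preimage is [0,1) times itself.\<close>

lemma contractible_space_cone:
  assumes y: "y \<in> topspace X" and cone: "\<And>U. openin X U \<Longrightarrow> y \<in> U \<Longrightarrow> U = topspace X"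
  shows "contractible_space X"
proof -
  let ?I = "top_of_set {0..1::real}"
  let ?h = "\<lambda>(t::real, x). if t < 1 then x else y"
  have "continuous_map (prod_topology ?I X) X ?h"
    unfolding continuous_map
  proof (intro conjI allI impI)
    show "?h ` topspace (prod_topology ?I X) \<subseteq> topspace X" using y by auto
    fix U assume U: "openin X U"
    show "openin (prod_topology ?I X) {z \<in> topspace (prod_topology ?I X). ?h z \<in> U}"
    proof (cases "y \<in> U")
      case True
      then have "U = topspace X" using cone U by blast
      then have "{z \<in> topspace (prod_topology ?I X). ?h z \<in> U} = topspace (prod_topology ?I X)"
        using y by auto
      then show ?thesis by (metis openin_topspace)
    next
      case False
      then have "{z \<in> topspace (prod_topology ?I X). ?h z \<in> U} = ({0..1} \<inter> {..<1}) \<times> U"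
        using openin_subset[OF U] by (auto split: if_splits)
      moreover have "openin ?I ({0..1} \<inter> {..<1})" by (intro openin_open_Int) auto
      ultimately show ?thesis using U by (simp add: openin_prod_Times_iff)
    qed
  qed
  then have "homotopic_with (\<lambda>x. True) X X id (\<lambda>x. y)"
    unfolding homotopic_with_def by (intro exI[of _ ?h]) auto
  then show ?thesis unfolding contractible_space_def by blast
qed

lemma contractible_space_subset_min_open:
  assumes "y \<in> topspace X" "y \<in> S" "S \<subseteq> min_open X y"
  shows "contractible_space (subtopology X S)"
proof (rule contractible_space_cone[of y])
  show "y \<in> topspace (subtopology X S)" using assms by simp
  fix U assume U: "openin (subtopology X S) U" "y \<in> U"
  then obtain W where "openin X W" "U = W \<inter> S" by (auto simp: openin_subtopology)
  then show "U = topspace (subtopology X S)"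
    using assms U(2) min_open_subset[of X W y] openin_subset[of X W] by auto
qed

text \<open>A point whose closure has least cardinality: every point of that closure has the same
  closure and is therefore the same point by T0.\<close>

lemma finite_t0_closed_point:
  assumes "finite (topspace X)" "t0_space X" "topspace X \<noteq> {}"
  obtains y where "y \<in> topspace X" "closedin X {y}"
proof -
  obtain y where y: "y \<in> topspace X"
    and min: "\<And>z. z \<in> topspace X \<Longrightarrow> card (X closure_of {y}) \<le> card (X closure_of {z})"
    using assms(3) ex_has_least_nat[of "\<lambda>y. y \<in> topspace X" _ "\<lambda>y. card (X closure_of {y})"] by blast
  have "X closure_of {y} \<subseteq> {y}"
  proof
    fix z assume z: "z \<in> X closure_of {y}"
    then have zX: "z \<in> topspace X" by (meson closure_of_subset_topspace subsetD)
    have sub: "X closure_of {z} \<subseteq> X closure_of {y}" using z by (simp add: closure_of_minimal)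
    moreover have "finite (X closure_of {y})"
      using assms(1) closure_of_subset_topspace finite_subset by metis
    ultimately have "X closure_of {z} = X closure_of {y}"
      using min[OF zX] by (simp add: card_subset_eq card_mono le_antisym)
    then show "z \<in> {y}" using assms(2) y zX by (simp add: t0_space_closure_of_sing)
  qed
  then have "X closure_of {y} = {y}" using closure_of_subset[of "{y}" X] y by auto
  then show thesis using that y by (metis closedin_closure_of)
qed

text \<open>The members of the family need not be open. For two sets these chains form the sum of
  the two subcomplexes, and excision amounts to showing that chains modulo small ones have no
  homology.\<close>

definition small_chain :: "nat \<Rightarrow> 'a topology \<Rightarrow> 'a set set \<Rightarrow> 'a chain \<Rightarrow> bool" where
  "small_chain p X \<C> c \<longleftrightarrow>
     (\<forall>f\<in>Poly_Mapping.keys c. \<exists>C\<in>\<C>. singular_simplex p (subtopology X C) f)"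

lemma small_chain_single [simp]: "small_chain p X {C} c \<longleftrightarrow> singular_chain p (subtopology X C) c"
  by (auto simp: small_chain_def singular_chain_def)

lemma small_chain_0 [simp]: "small_chain p X \<C> 0"
  by (simp add: small_chain_def)

lemma small_chain_diff:
  "small_chain p X \<C> a \<Longrightarrow> small_chain p X \<C> b \<Longrightarrow> small_chain p X \<C> (a - b)"
  unfolding small_chain_def using keys_diff[of a b] by blast

lemma small_chain_add:
  "small_chain p X \<C> a \<Longrightarrow> small_chain p X \<C> b \<Longrightarrow> small_chain p X \<C> (a + b)"
  unfolding small_chain_def using keys_add[of a b] by blast

lemma small_chain_mono:
  "small_chain p X \<C> c \<Longrightarrow> (\<And>C. C \<in> \<C> \<Longrightarrow> \<exists>D\<in>\<D>. C \<subseteq> D) \<Longrightarrow> small_chain p X \<D> c"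
  unfolding small_chain_def by (meson singular_simplex_mono)

text \<open>Smallness is a condition on single simplices, so two families can be imposed at once by
  intersecting their members.\<close>

lemma small_chain_Int:
  assumes "small_chain p X \<C> c" "small_chain p X \<D> c"
    and "\<And>C D. C \<in> \<C> \<Longrightarrow> D \<in> \<D> \<Longrightarrow> C \<inter> D \<in> \<E>"
  shows "small_chain p X \<E> c"
  unfolding small_chain_def
proof
  fix f assume "f \<in> Poly_Mapping.keys c"
  then obtain C D where CD: "C \<in> \<C>" "D \<in> \<D>"
    and "singular_simplex p (subtopology X C) f" "singular_simplex p (subtopology X D) f"
    using assms unfolding small_chain_def by meson
  then have "singular_simplex p (subtopology X (C \<inter> D)) f"
    by (auto simp: singular_simplex_subtopology)
  then show "\<exists>E\<in>\<E>. singular_simplex p (subtopology X E) f" using assms(3) CD by blast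
qed

lemma small_chain_Un_split:
  assumes "small_chain p X (\<C> \<union> \<D>) c"
  obtains d e where "small_chain p X \<C> d" "small_chain p X \<D> e" "c = d + e"
proof -
  have "Poly_Mapping.keys c \<subseteq> {f. \<exists>C\<in>\<C>. singular_simplex p (subtopology X C) f}
     \<union> {f. \<exists>C\<in>\<D>. singular_simplex p (subtopology X C) f}"
    using assms unfolding small_chain_def by blast
  then obtain d e where "Poly_Mapping.keys d \<subseteq> {f. \<exists>C\<in>\<C>. singular_simplex p (subtopology X C) f}"
    "Poly_Mapping.keys e \<subseteq> {f. \<exists>C\<in>\<D>. singular_simplex p (subtopology X C) f}" "d + e = c"
    by (rule frag_split)
  then show thesis by (intro that[of d e]) (auto simp: small_chain_def)
qed

lemma small_chain_pair_split:
  assumes "small_chain p X {C, D} c"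
  obtains d e where "singular_chain p (subtopology X C) d" "singular_chain p (subtopology X D) e"
    "c = d + e"
  using small_chain_Un_split[of p X "{C}" "{D}" c] assms by (auto simp: insert_commute)

text \<open>Meant for operators that act within every subspace, such as the boundary and the
  subdivision homotopy; linearity reduces the claim to single simplices.\<close>

lemma small_chain_linear_image:
  assumes "small_chain p X \<C> c"
    and "h 0 = 0" "\<And>a b. h (a - b) = h a - h b"
    and "\<And>C a. singular_chain p (subtopology X C) a \<Longrightarrow> singular_chain q (subtopology X C) (h a)"
  shows "small_chain q X \<C> (h c)"
proof -
  have "Poly_Mapping.keys c \<subseteq> {f. \<exists>C\<in>\<C>. singular_simplex p (subtopology X C) f}"
    using assms(1) by (auto simp: small_chain_def)
  then show ?thesis
  proof (induction c rule: frag_induction)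
    case (one f)
    then obtain C where "C \<in> \<C>" "singular_chain p (subtopology X C) (frag_of f)"
      by (auto simp: singular_chain_of)
    with assms(4) have "C \<in> \<C>" "singular_chain q (subtopology X C) (h (frag_of f))" by auto
    then show ?case by (auto simp: small_chain_def singular_chain_def)
  qed (use assms(2,3) in \<open>auto intro: small_chain_diff\<close>)
qed

lemma small_chain_boundary:
  "small_chain p X \<C> c \<Longrightarrow> small_chain (p - Suc 0) X \<C> (chain_boundary p c)"
  by (erule small_chain_linear_image) (simp_all add: chain_boundary_diff singular_chain_boundary)

section \<open>From vanishing homology to fillings of chains\<close>

lemma relboundary_of_trivial_homology:
  assumes "trivial_group (relative_homology_group (int p) X S)" "singular_relcycle p X S c"
  shows "singular_relboundary p X S c"
proof -
  have "homologous_rel_set p X S c \<in> carrier (relative_homology_group (int p) X S)"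
    using assms(2) unfolding carrier_relative_homology_group by blast
  then have "homologous_rel_set p X S c = singular_relboundary_set p X S"
    using assms(1) unfolding trivial_group_def by simp
  then show ?thesis by (simp only: homologous_rel_set_eq_relboundary)
qed

lemma relcycle_subtopology:
  "singular_relcycle p (subtopology X U) S c \<longleftrightarrow>
     singular_chain p (subtopology X U) c \<and> singular_chain (p - 1) (subtopology X (U \<inter> S)) (chain_boundary p c)"
  by (simp add: singular_relcycle subtopology_subtopology)

lemma relboundary_subtopology:
  "singular_relboundary p (subtopology X U) S c \<longleftrightarrow>
    (\<exists>d e. singular_chain (Suc p) (subtopology X U) d \<and> singular_chain p (subtopology X (U \<inter> S)) e \<and>
      c = chain_boundary (Suc p) d + e)"
  by (auto simp: singular_relboundary subtopology_subtopology)

lemma singular_chain_subtopology_Int: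
  "singular_chain p (subtopology X (C \<inter> D)) c \<longleftrightarrow>
    singular_chain p (subtopology X C) c \<and> singular_chain p (subtopology X D) c"
  by (fastforce simp: singular_chain_subtopology)

text \<open>If \<open>y\<close> lies outside \<open>A\<close> or outside \<open>B\<close>, then
  \<open>U\<close> misses that set altogether and \<open>c\<close> is already small. Otherwise
  \<open>U\<close> and its intersections with \<open>A\<close>, with \<open>B\<close> and with both
  are cones with apex \<open>y\<close>, so their pairs have no homology: the \<open>A\<close> part
  of the boundary is filled in \<open>U \<inter> A\<close>, and the rest of \<open>c\<close> in
  \<open>U\<close> modulo \<open>U \<inter> B\<close>.\<close>

lemma small_fill_min_open:
  assumes "finite (topspace X)" "closedin X A" "closedin X B" "topspace X \<subseteq> A \<union> B"
    and y: "y \<in> topspace X" and U: "U = min_open X y"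
    and c: "singular_chain p (subtopology X U) c"
    and bc: "small_chain (p - 1) X {U \<inter> A, U \<inter> B} (chain_boundary p c)"
  shows "\<exists>d. singular_chain (Suc p) (subtopology X U) d \<and>
             small_chain p X {U \<inter> A, U \<inter> B} (c - chain_boundary (Suc p) d)"
proof (cases "y \<in> A \<inter> B")
  case False
  have "U \<subseteq> topspace X" using U by (auto simp: min_open_def)
  with False have "U \<inter> A = U \<or> U \<inter> B = U"
    using min_open_closed_disjoint[OF assms(2), of y] min_open_closed_disjoint[OF assms(3), of y]
      y assms(4) U by blast
  then have "small_chain p X {U \<inter> A, U \<inter> B} c"
    using small_chain_mono[of p X "{U}" c "{U \<inter> A, U \<inter> B}"] c by fastforce
  then show ?thesis by (intro exI[of _ 0]) simp
next
  case True
  have yU: "y \<in> U" using y U mem_min_open by metis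
  have contr: "contractible_space (subtopology X (U \<inter> S))" if "y \<in> S" for S
    by (rule contractible_space_subset_min_open[OF y]) (use that yU U in auto)
  have triv: "trivial_group (relative_homology_group k (subtopology X (U \<inter> R)) S)"
    if "y \<in> R" "y \<in> S" for k R S
    by (rule trivial_relative_homology_group_contractible_spaces)
       (use that contr[of R] contr[of "R \<inter> S"] y yU in \<open>auto simp: subtopology_subtopology Int_assoc\<close>)
  have fillB: "\<exists>d e. singular_chain (Suc p) (subtopology X U) d \<and> singular_chain p (subtopology X (U \<inter> B)) e
      \<and> c = chain_boundary (Suc p) d + e"
    if "singular_chain p (subtopology X U) c"
      "singular_chain (p - 1) (subtopology X (U \<inter> B)) (chain_boundary p c)" for c
    using relboundary_of_trivial_homology[OF triv[of UNIV B p], of c] True that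
    by (simp add: relcycle_subtopology relboundary_subtopology)
  have "\<exists>a'. singular_chain p (subtopology X (U \<inter> A)) a' \<and>
      singular_chain (p - 1) (subtopology X (U \<inter> B)) (chain_boundary p (c - a'))"
  proof (cases p)
    \<comment> \<open>The boundary in degree 0 is 0 and \<open>p - 1\<close> is truncated, so there
      is no boundary to correct.\<close>
    case 0
    then show ?thesis by (intro exI[of _ 0]) (simp add: chain_boundary_def)
  next
    case (Suc q)
    obtain a b where a: "singular_chain q (subtopology X (U \<inter> A)) a"
      and b: "singular_chain q (subtopology X (U \<inter> B)) b" and ab: "chain_boundary p c = a + b"
      using small_chain_pair_split[OF bc] Suc by auto
    have "chain_boundary q (a + b) = 0"
      using chain_boundary_boundary_alt[of q "subtopology X U" c] c Suc ab by simp
    then have eq: "chain_boundary q a = - chain_boundary q b"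
      by (simp add: chain_boundary_add eq_neg_iff_add_eq_0)
    \<comment> \<open>The boundary of \<open>a\<close> is minus that of \<open>b\<close>, so it lies
      in both parts; this makes \<open>a\<close> a relative cycle of a pair of cones.\<close>
    have "singular_chain (q - 1) (subtopology X ((U \<inter> A) \<inter> (U \<inter> B))) (chain_boundary q a)"
      unfolding singular_chain_subtopology_Int[of _ _ "U \<inter> A"]
      using singular_chain_boundary[OF a] singular_chain_boundary[OF b] eq
      by (simp add: singular_chain_minus)
    then have "singular_relcycle q (subtopology X (U \<inter> A)) B a"
      using a by (simp add: relcycle_subtopology Int_ac)
    then have "singular_relboundary q (subtopology X (U \<inter> A)) B a"
      using relboundary_of_trivial_homology triv True by blast
    then obtain a' e where a': "singular_chain p (subtopology X (U \<inter> A)) a'"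
      and e: "singular_chain q (subtopology X (U \<inter> A \<inter> B)) e" and "a = chain_boundary p a' + e"
      using Suc unfolding relboundary_subtopology by blast
    then have "chain_boundary p (c - a') = e + b" using ab by (simp add: chain_boundary_diff)
    moreover have "singular_chain q (subtopology X (U \<inter> B)) (e + b)"
      using b singular_chain_mono[OF e, of "U \<inter> B"] by (intro singular_chain_add) auto
    ultimately show ?thesis using a' Suc by auto
  qed
  then obtain a' where a': "singular_chain p (subtopology X (U \<inter> A)) a'"
    and ba': "singular_chain (p - 1) (subtopology X (U \<inter> B)) (chain_boundary p (c - a'))" by blast
  have "singular_chain p (subtopology X U) (c - a')"
    using c singular_chain_mono[OF a', of U] by (intro singular_chain_diff) auto
  then obtain d e where d: "singular_chain (Suc p) (subtopology X U) d"
    and e: "singular_chain p (subtopology X (U \<inter> B)) e" and "c - a' = chain_boundary (Suc p) d + e"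
    using fillB ba' by blast
  then have "c - chain_boundary (Suc p) d = a' + e" by (simp add: algebra_simps)
  moreover have "small_chain p X {U \<inter> A, U \<inter> B} (a' + e)"
    using a' e by (intro small_chain_add) (auto simp: small_chain_def singular_chain_def)
  ultimately show ?thesis using d by metis
qed

text \<open>Barycentric subdivision applies because \<open>U1\<close> and \<open>U2\<close> are
  open. The chain homotopy \<open>h\<close> between its \<open>n\<close>-th iterate and the identity
  contributes the last two terms; as \<open>h\<close> acts within every subspace, it keeps the
  boundary small for an arbitrary family \<C>.\<close>

lemma small_subdivision:
  assumes U: "openin X U1" "openin X U2" and c: "singular_chain p (subtopology X (U1 \<union> U2)) c"
    and bc: "small_chain (p - 1) X \<C> (chain_boundary p c)"
  obtains c1 c2 d e where "singular_chain p (subtopology X U1) c1" "singular_chain p (subtopology X U2) c2"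
    "singular_chain (Suc p) (subtopology X (U1 \<union> U2)) d" "small_chain p X \<C> e"
    "c = c1 + c2 + chain_boundary (Suc p) d + e"
proof -
  let ?X = "subtopology X (U1 \<union> U2)"
  have ops: "openin ?X V" if "V \<in> {U1, U2}" for V
    using that U by (auto simp: openin_subtopology)
  have cov: "topspace ?X \<subseteq> \<Union>{U1, U2}" by auto
  obtain n where n: "\<And>m f. \<lbrakk>n \<le> m; f \<in> Poly_Mapping.keys ((singular_subdivision p ^^ m) c)\<rbrakk>
      \<Longrightarrow> \<exists>V \<in> {U1, U2}. f \<in> (standard_simplex p) \<rightarrow> V"
    by (rule sufficient_iterated_singular_subdivision_exists[OF ops cov c]) blast+
  obtain h where h0: "\<And>p. h p 0 = (0 :: 'a chain)"
    and hd: "\<And>p c1 c2. h p (c1-c2) = h p c1 - h p c2"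
    and hc: "\<And>p X c. singular_chain p X c \<Longrightarrow> singular_chain (Suc p) X (h p c)"
    and hb: "\<And>p X c. singular_chain p X c
       \<Longrightarrow> chain_boundary (Suc p) (h p c) + h (p - Suc 0) (chain_boundary p c)
         = (singular_subdivision p ^^ n) c - c"
    using chain_homotopic_iterated_singular_subdivision[of n] by blast
  let ?c' = "(singular_subdivision p ^^ n) c"
  have "singular_chain p ?X ((singular_subdivision p ^^ m) c)" for m
    by (induction m) (auto simp: singular_chain_singular_subdivision c)
  then have c': "singular_chain p ?X ?c'" .
  have "small_chain p X ({U1} \<union> {U2}) ?c'"
    unfolding small_chain_def
  proof
    fix f assume f: "f \<in> Poly_Mapping.keys ?c'"
    then have "singular_simplex p X f"
      using c' by (auto simp: singular_chain_def singular_simplex_subtopology)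
    with n[OF le_refl f] show "\<exists>C\<in>{U1} \<union> {U2}. singular_simplex p (subtopology X C) f"
      by (auto simp: singular_simplex_subtopology)
  qed
  then obtain c1 c2 where c12: "singular_chain p (subtopology X U1) c1"
    "singular_chain p (subtopology X U2) c2" "?c' = c1 + c2"
    using small_chain_Un_split[of p X "{U1}" "{U2}"] by (metis small_chain_single)
  have hs: "small_chain p X \<C> (h (p - Suc 0) (chain_boundary p c))"
  proof (cases p)
    case 0
    then show ?thesis by (simp add: chain_boundary_def h0)
  next
    case (Suc q)
    show ?thesis
      by (rule small_chain_linear_image[OF bc]) (use h0 hd hc Suc in auto)
  qed
  show thesis
  proof (rule that[OF c12(1,2)])
    show "singular_chain (Suc p) ?X (- h p c)" using hc[OF c] by (simp add: singular_chain_minus)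
    show "small_chain p X \<C> (- h (p - Suc 0) (chain_boundary p c))"
      using small_chain_diff[OF small_chain_0 hs] by simp
    show "c = c1 + c2 + chain_boundary (Suc p) (- h p c) + - h (p - Suc 0) (chain_boundary p c)"
      using hb[OF c] c12(3) by (simp add: chain_boundary_minus algebra_simps)
  qed
qed

section \<open>Excision for closed covers of finite spaces\<close>

text \<open>A Mayer--Vietoris step: glue fillings over \<open>U1\<close> and \<open>U2\<close> along one over \<open>U1 \<inter> U2\<close>.\<close>

lemma small_fill_Un:
  assumes op: "openin X U1" "openin X U2"
    and fill1: "\<And>c. \<lbrakk>singular_chain p (subtopology X U1) c;
        small_chain (p - 1) X {U1 \<inter> A, U1 \<inter> B} (chain_boundary p c)\<rbrakk>
      \<Longrightarrow> \<exists>d. singular_chain (Suc p) (subtopology X U1) d \<and>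
             small_chain p X {U1 \<inter> A, U1 \<inter> B} (c - chain_boundary (Suc p) d)"
    and fill2: "\<And>c. \<lbrakk>singular_chain p (subtopology X U2) c;
        small_chain (p - 1) X {U2 \<inter> A, U2 \<inter> B} (chain_boundary p c)\<rbrakk>
      \<Longrightarrow> \<exists>d. singular_chain (Suc p) (subtopology X U2) d \<and>
             small_chain p X {U2 \<inter> A, U2 \<inter> B} (c - chain_boundary (Suc p) d)"
    and fill12: "\<And>q c. \<lbrakk>singular_chain q (subtopology X (U1 \<inter> U2)) c;
        small_chain (q - 1) X {U1 \<inter> U2 \<inter> A, U1 \<inter> U2 \<inter> B} (chain_boundary q c)\<rbrakk>
      \<Longrightarrow> \<exists>d. singular_chain (Suc q) (subtopology X (U1 \<inter> U2)) d \<and>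
             small_chain q X {U1 \<inter> U2 \<inter> A, U1 \<inter> U2 \<inter> B} (c - chain_boundary (Suc q) d)"
    and U: "U = U1 \<union> U2"
    and c: "singular_chain p (subtopology X U) c"
    and bc: "small_chain (p - 1) X {U \<inter> A, U \<inter> B} (chain_boundary p c)"
  shows "\<exists>d. singular_chain (Suc p) (subtopology X U) d \<and>
             small_chain p X {U \<inter> A, U \<inter> B} (c - chain_boundary (Suc p) d)"
proof -
  obtain c1 c2 d e where c1: "singular_chain p (subtopology X U1) c1"
    and c2: "singular_chain p (subtopology X U2) c2"
    and d: "singular_chain (Suc p) (subtopology X U) d" and e: "small_chain p X {U \<inter> A, U \<inter> B} e"
    and ceq: "c = c1 + c2 + chain_boundary (Suc p) d + e"
    using small_subdivision[OF op c[unfolded U] bc] unfolding U by blast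
  \<comment> \<open>Only the sum of the boundaries of \<open>c1\<close> and \<open>c2\<close> is
    known to be small. Shifting \<open>g\<close> from one summand to the other makes each of them
    small.\<close>
  have "\<exists>g. singular_chain p (subtopology X (U1 \<inter> U2)) g \<and>
      small_chain (p - 1) X {U1 \<inter> A, U1 \<inter> B} (chain_boundary p (c1 - g)) \<and>
      small_chain (p - 1) X {U2 \<inter> A, U2 \<inter> B} (chain_boundary p (c2 + g))"
  proof (cases p)
    case 0
    then show ?thesis by (intro exI[of _ 0]) (simp add: chain_boundary_def)
  next
    case (Suc q)
    define \<gamma> where "\<gamma> = chain_boundary p c1 + chain_boundary p c2"
    have b1: "singular_chain q (subtopology X U1) (chain_boundary p c1)"
      and b2: "singular_chain q (subtopology X U2) (chain_boundary p c2)"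
      using singular_chain_boundary[OF c1] singular_chain_boundary[OF c2] Suc by simp_all
    have "chain_boundary p (chain_boundary (Suc p) d) = 0"
      using d chain_boundary_boundary_alt by blast
    then have "\<gamma> = chain_boundary p c - chain_boundary p e"
      by (simp add: \<gamma>_def ceq chain_boundary_add)
    then have \<gamma>AB: "small_chain q X {U \<inter> A, U \<inter> B} \<gamma>"
      using small_chain_diff[OF bc] small_chain_boundary[OF e] Suc by simp
    have "small_chain q X {U1, U2} \<gamma>"
      unfolding \<gamma>_def using b1 b2
      by (intro small_chain_add) (auto simp: small_chain_def singular_chain_def)
    then have "small_chain q X ({U1 \<inter> A, U1 \<inter> B} \<union> {U2 \<inter> A, U2 \<inter> B}) \<gamma>"
      by (rule small_chain_Int[OF _ \<gamma>AB]) (auto simp: U)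
    then obtain \<gamma>1 \<gamma>2 where \<gamma>1: "small_chain q X {U1 \<inter> A, U1 \<inter> B} \<gamma>1"
      and \<gamma>2: "small_chain q X {U2 \<inter> A, U2 \<inter> B} \<gamma>2" and \<gamma>eq: "\<gamma> = \<gamma>1 + \<gamma>2"
      by (rule small_chain_Un_split)
    have s1: "singular_chain q (subtopology X U1) \<gamma>1"
      using small_chain_mono[OF \<gamma>1, of "{U1}"] by auto
    have s2: "singular_chain q (subtopology X U2) \<gamma>2"
      using small_chain_mono[OF \<gamma>2, of "{U2}"] by auto
    \<comment> \<open>The defect of \<open>c1\<close>. Up to sign it is also the defect of
      \<open>c2\<close>, so it lies in \<open>U1 \<inter> U2\<close>; filling it there, one degree
      lower, yields \<open>g\<close>.\<close>
    define f where "f = chain_boundary p c1 - \<gamma>1"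
    have f': "f = \<gamma>2 - chain_boundary p c2" using \<gamma>eq by (simp add: f_def \<gamma>_def algebra_simps)
    have f: "singular_chain q (subtopology X (U1 \<inter> U2)) f"
      unfolding singular_chain_subtopology_Int
      using singular_chain_diff[OF b1 s1] singular_chain_diff[OF s2 b2] f' f_def by simp
    have bf: "chain_boundary q f = 0 - chain_boundary q \<gamma>1"
      using chain_boundary_boundary_alt[of q "subtopology X U1" c1] c1 Suc
      by (simp add: f_def chain_boundary_diff)
    have "small_chain (q - 1) X {U1 \<inter> A, U1 \<inter> B} (chain_boundary q f)"
      unfolding bf using small_chain_boundary[OF \<gamma>1] by (intro small_chain_diff) simp_all
    moreover have "small_chain (q - 1) X {U1 \<inter> U2} (chain_boundary q f)"
      using singular_chain_boundary[OF f] by simp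
    ultimately have sbf: "small_chain (q - 1) X {U1 \<inter> U2 \<inter> A, U1 \<inter> U2 \<inter> B} (chain_boundary q f)"
      by (rule small_chain_Int) auto
    then obtain g where g: "singular_chain (Suc q) (subtopology X (U1 \<inter> U2)) g"
      and fg: "small_chain q X {U1 \<inter> U2 \<inter> A, U1 \<inter> U2 \<inter> B} (f - chain_boundary (Suc q) g)"
      using fill12[OF f sbf] by blast
    have fg1: "small_chain q X {U1 \<inter> A, U1 \<inter> B} (f - chain_boundary (Suc q) g)"
      by (rule small_chain_mono[OF fg]) auto
    have fg2: "small_chain q X {U2 \<inter> A, U2 \<inter> B} (f - chain_boundary (Suc q) g)"
      by (rule small_chain_mono[OF fg]) auto
    have "chain_boundary p (c1 - g) = (f - chain_boundary (Suc q) g) + \<gamma>1"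
      using Suc by (simp add: f_def chain_boundary_diff algebra_simps)
    moreover have "chain_boundary p (c2 + g) = \<gamma>2 - (f - chain_boundary (Suc q) g)"
      using Suc by (simp add: f' chain_boundary_add algebra_simps)
    ultimately show ?thesis
      using g small_chain_add[OF fg1 \<gamma>1] small_chain_diff[OF \<gamma>2 fg2] Suc by auto
  qed
  then obtain g where g: "singular_chain p (subtopology X (U1 \<inter> U2)) g"
    and g1: "small_chain (p - 1) X {U1 \<inter> A, U1 \<inter> B} (chain_boundary p (c1 - g))"
    and g2: "small_chain (p - 1) X {U2 \<inter> A, U2 \<inter> B} (chain_boundary p (c2 + g))" by blast
  have g': "singular_chain p (subtopology X U1) g" "singular_chain p (subtopology X U2) g"
    using g by (simp_all add: singular_chain_subtopology_Int)
  obtain d1 where d1: "singular_chain (Suc p) (subtopology X U1) d1"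
    "small_chain p X {U1 \<inter> A, U1 \<inter> B} (c1 - g - chain_boundary (Suc p) d1)"
    using fill1[OF singular_chain_diff[OF c1 g'(1)] g1] by blast
  obtain d2 where d2: "singular_chain (Suc p) (subtopology X U2) d2"
    "small_chain p X {U2 \<inter> A, U2 \<inter> B} (c2 + g - chain_boundary (Suc p) d2)"
    using fill2[OF singular_chain_add[OF c2 g'(2)] g2] by blast
  show ?thesis
  proof (intro exI conjI)
    show "singular_chain (Suc p) (subtopology X U) (d1 + d2 + d)"
      using singular_chain_mono[OF d1(1), of U] singular_chain_mono[OF d2(1), of U] d U
      by (intro singular_chain_add) auto
    have "c - chain_boundary (Suc p) (d1 + d2 + d)
      = (c1 - g - chain_boundary (Suc p) d1) + (c2 + g - chain_boundary (Suc p) d2) + e"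
      by (simp add: ceq chain_boundary_add algebra_simps)
    moreover have "small_chain p X {U \<inter> A, U \<inter> B} (c1 - g - chain_boundary (Suc p) d1)"
      by (rule small_chain_mono[OF d1(2)]) (auto simp: U)
    moreover have "small_chain p X {U \<inter> A, U \<inter> B} (c2 + g - chain_boundary (Suc p) d2)"
      by (rule small_chain_mono[OF d2(2)]) (auto simp: U)
    ultimately show "small_chain p X {U \<inter> A, U \<inter> B} (c - chain_boundary (Suc p) (d1 + d2 + d))"
      using e by (metis small_chain_add)
  qed
qed

text \<open>Induction on the size of \<open>U\<close>, split at a closed point \<open>y\<close> of
  \<open>U\<close> into its minimal neighbourhood and \<open>U - {y}\<close>. The neighbourhood may
  be all of \<open>U\<close>, so it is settled by \<open>small_fill_min_open\<close>;
  \<open>U - {y}\<close> and the overlap omit \<open>y\<close> and are smaller. The degree varies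
  because the overlap is filled one degree lower.\<close>

lemma small_fill:
  assumes fin: "finite (topspace X)" and t0: "t0_space X"
    and AB: "closedin X A" "closedin X B" "topspace X \<subseteq> A \<union> B"
    and "openin X U"
    and "singular_chain p (subtopology X U) c"
    and "small_chain (p - 1) X {U \<inter> A, U \<inter> B} (chain_boundary p c)"
  shows "\<exists>d. singular_chain (Suc p) (subtopology X U) d \<and>
             small_chain p X {U \<inter> A, U \<inter> B} (c - chain_boundary (Suc p) d)"
  using assms(6-)
proof (induction "card U" arbitrary: U p c rule: less_induct)
  case less
  have UX: "U \<subseteq> topspace X" using less.prems(1) openin_subset by blast
  then have finU: "finite U" using fin finite_subset by blast
  show ?case
  proof (cases "U = {}")
    case True
    then show ?thesis using less.prems(2) by (intro exI[of _ 0]) (simp add: singular_chain_empty)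
  next
    case False
    have tU: "topspace (subtopology X U) = U" using UX by auto
    obtain y where yU: "y \<in> U" and y: "closedin (subtopology X U) {y}"
      using finite_t0_closed_point[of "subtopology X U"] t0_space_subtopology[OF t0, of U] finU False
      unfolding tU by blast
    have yX: "y \<in> topspace X" using yU UX by blast
    have "openin (subtopology X U) (U - {y})" using y unfolding closedin_def tU by blast
    then have op2: "openin X (U - {y})" using less.prems(1) openin_trans_full by blast
    let ?M = "min_open X y"
    have sub: "?M \<subseteq> U" using min_open_subset less.prems(1) yU by metis
    have op1: "openin X ?M" by (rule openin_min_open[OF fin])
    have yM: "y \<in> ?M" using mem_min_open[OF yX] .
    show ?thesis
    proof (rule small_fill_Un[OF op1 op2])
      show "U = ?M \<union> (U - {y})" using sub yM yU by auto
      have small: "card (?M \<inter> (U - {y})) < card U" "card (U - {y}) < card U"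
        using finU yU by (blast intro: psubset_card_mono)+
      show "\<exists>d. singular_chain (Suc q) (subtopology X (?M \<inter> (U - {y}))) d \<and>
          small_chain q X {?M \<inter> (U - {y}) \<inter> A, ?M \<inter> (U - {y}) \<inter> B} (c - chain_boundary (Suc q) d)"
        if "singular_chain q (subtopology X (?M \<inter> (U - {y}))) c"
          "small_chain (q - 1) X {?M \<inter> (U - {y}) \<inter> A, ?M \<inter> (U - {y}) \<inter> B} (chain_boundary q c)" for q c
        by (rule less.hyps[OF small(1) openin_Int[OF op1 op2] that])
      show "\<exists>d. singular_chain (Suc p) (subtopology X (U - {y})) d \<and>
          small_chain p X {(U - {y}) \<inter> A, (U - {y}) \<inter> B} (c - chain_boundary (Suc p) d)"
        if "singular_chain p (subtopology X (U - {y})) c"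
          "small_chain (p - 1) X {(U - {y}) \<inter> A, (U - {y}) \<inter> B} (chain_boundary p c)" for c
        by (rule less.hyps[OF small(2) op2 that])
      show "\<exists>d. singular_chain (Suc p) (subtopology X ?M) d \<and>
          small_chain p X {?M \<inter> A, ?M \<inter> B} (c - chain_boundary (Suc p) d)"
        if "singular_chain p (subtopology X ?M) c"
          "small_chain (p - 1) X {?M \<inter> A, ?M \<inter> B} (chain_boundary p c)" for c
        by (rule small_fill_min_open[OF fin AB yX refl that])
    qed (use less.prems in auto)
  qed
qed

text \<open>A chain with small boundary is small up to a boundary. For a relative cycle this gives
  surjectivity; one degree higher, for a chain that bounds a cycle of \<open>A\<close> modulo
  \<open>B\<close>, it gives injectivity.\<close>

theorem closed_excision:
  assumes fin: "finite (topspace X)" and t0: "t0_space X"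
    and AB: "closedin X A" "closedin X B" "topspace X \<subseteq> A \<union> B"
  shows "hom_induced p (subtopology X A) (A \<inter> B) X B id
    \<in> iso (relative_homology_group p (subtopology X A) (A \<inter> B)) (relative_homology_group p X B)"
proof (cases "p < 0")
  case True
  then show ?thesis
    unfolding iso_def bij_betw_def relative_homology_group_def by (simp add: hom_induced_trivial)
next
  case False
  then obtain n where peq: "p = int n"
    by (metis int_nat_eq not_le)
  let ?A = "subtopology X A" and ?C = "A \<inter> B"
  have cont: "continuous_map ?A X id" by (simp add: continuous_map_from_subtopology)
  have fill: "\<exists>d a b. singular_chain (Suc q) X d \<and> singular_chain q (subtopology X A) a \<and>
      singular_chain q (subtopology X B) b \<and> c = chain_boundary (Suc q) d + a + b"
    if c: "singular_chain q X c" and bc: "small_chain (q - 1) X {A, B} (chain_boundary q c)" for q c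
  proof -
    have [simp]: "topspace X \<inter> A = A" "topspace X \<inter> B = B"
      using AB by (auto dest: closedin_subset)
    obtain d where d: "singular_chain (Suc q) X d"
      "small_chain q X {A, B} (c - chain_boundary (Suc q) d)"
      using small_fill[OF fin t0 AB, of "topspace X" q c] c bc by auto
    obtain a b where "singular_chain q (subtopology X A) a" "singular_chain q (subtopology X B) b"
      "c - chain_boundary (Suc q) d = a + b"
      using small_chain_pair_split[OF d(2)] .
    moreover from this have "c = chain_boundary (Suc q) d + a + b" by (simp add: algebra_simps)
    ultimately show ?thesis using d(1) by blast
  qed
  have smallAB: "small_chain q X {A, B} a" if "singular_chain q (subtopology X A) a" for q a
    using that by (auto simp: small_chain_def singular_chain_def)
  have smallBA: "small_chain q X {A, B} a" if "singular_chain q (subtopology X B) a" for q a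
    using that by (auto simp: small_chain_def singular_chain_def)
  have AX: "singular_chain q X a" if "singular_chain q ?A a" for q a
    using that by (simp add: singular_chain_subtopology)
  have relA: "singular_relcycle n ?A ?C c \<longleftrightarrow>
      singular_chain n ?A c \<and> singular_chain (n - 1) (subtopology X B) (chain_boundary n c)" for c
    unfolding relcycle_subtopology using singular_chain_boundary[of n ?A c]
    by (auto simp: singular_chain_subtopology_Int)
  have relAX: "singular_relcycle n X B c" if "singular_relcycle n ?A ?C c" for c
    using that AX unfolding relA by (simp add: singular_relcycle)
  have img: "hom_induced p ?A ?C X B id (homologous_rel_set n ?A ?C c) = homologous_rel_set n X B c"
    if c: "singular_relcycle n ?A ?C c" for c
  proof -
    have "chain_map n id c = c"
      using c AX chain_map_ident[of n X c] unfolding relA by blast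
    then show ?thesis using hom_induced_chain_map[OF cont _ c, of B] peq by simp
  qed
  have inj: "singular_relboundary n ?A ?C a"
    if a: "singular_relcycle n ?A ?C a" and rb: "singular_relboundary n X B a" for a
  proof -
    have aA: "singular_chain n ?A a" using a relA by blast
    obtain d b where d: "singular_chain (Suc n) X d" and b: "singular_chain n (subtopology X B) b"
      and eq: "a = chain_boundary (Suc n) d + b"
      using rb unfolding singular_relboundary by metis
    have "chain_boundary (Suc n) d = a - b" using eq by simp
    then have "small_chain n X {A, B} (chain_boundary (Suc n) d)"
      using small_chain_diff[OF smallAB[OF aA] smallBA[OF b]] by simp
    then obtain e a' b' where e: "singular_chain (Suc (Suc n)) X e"
      and a': "singular_chain (Suc n) ?A a'" and b': "singular_chain (Suc n) (subtopology X B) b'"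
      and "d = chain_boundary (Suc (Suc n)) e + a' + b'"
      using fill[OF d] by auto
    then have "chain_boundary (Suc n) d = chain_boundary (Suc n) a' + chain_boundary (Suc n) b'"
      using chain_boundary_boundary_alt[OF e] by (simp add: chain_boundary_add)
    \<comment> \<open>The left side lies in \<open>A\<close> and the right side in \<open>B\<close>,
      so both lie in \<open>A \<inter> B\<close>.\<close>
    then have r: "a - chain_boundary (Suc n) a' = b + chain_boundary (Suc n) b'" using eq by simp
    have "singular_chain n (subtopology X (A \<inter> B)) (a - chain_boundary (Suc n) a')"
      unfolding singular_chain_subtopology_Int
      using singular_chain_diff[OF aA singular_chain_boundary_alt[OF a']]
        singular_chain_add[OF b singular_chain_boundary_alt[OF b']] unfolding r[symmetric] by simp
    then show ?thesis unfolding relboundary_subtopology using a'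
      by (intro exI[of _ a'] exI[of _ "a - chain_boundary (Suc n) a'"]) simp
  qed
  have surj: "\<exists>a. singular_relcycle n ?A ?C a \<and> homologous_rel n X B a c"
    if c: "singular_relcycle n X B c" for c
  proof -
    have cX: "singular_chain n X c" and bc: "singular_chain (n - 1) (subtopology X B) (chain_boundary n c)"
      using c by (simp_all add: singular_relcycle)
    obtain d a b where d: "singular_chain (Suc n) X d" and a: "singular_chain n ?A a"
      and b: "singular_chain n (subtopology X B) b" and eq: "c = chain_boundary (Suc n) d + a + b"
      using fill[OF cX smallBA[OF bc]] by blast
    have "chain_boundary n a = chain_boundary n c - chain_boundary n b"
      using chain_boundary_boundary_alt[OF d] by (simp add: eq chain_boundary_add)
    then have "singular_relcycle n ?A ?C a"
      unfolding relA using a singular_chain_diff[OF bc] singular_chain_boundary[OF b] by simp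
    moreover have "homologous_rel n X B c a"
      unfolding homologous_rel_def singular_relboundary using d b eq by auto
    ultimately show ?thesis using homologous_rel_sym by blast
  qed
  show ?thesis
    unfolding iso_def bij_betw_def
  proof (intro CollectI conjI)
    show "inj_on (hom_induced p ?A ?C X B id) (carrier (relative_homology_group p ?A ?C))"
      unfolding peq carrier_relative_homology_group
    proof (rule inj_onI, clarify)
      fix c d assume c: "singular_relcycle n ?A ?C c" and d: "singular_relcycle n ?A ?C d"
        and "hom_induced (int n) ?A ?C X B id (homologous_rel_set n ?A ?C c)
           = hom_induced (int n) ?A ?C X B id (homologous_rel_set n ?A ?C d)"
      then have "homologous_rel n X B c d"
        using img peq by (simp add: homologous_rel_set_eq)
      then have "homologous_rel n ?A ?C c d"
        unfolding homologous_rel_def using inj singular_relcycle_diff[OF c d] by blast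
      then show "homologous_rel_set n ?A ?C c = homologous_rel_set n ?A ?C d"
        by (simp add: homologous_rel_set_eq)
    qed
    show "hom_induced p ?A ?C X B id ` carrier (relative_homology_group p ?A ?C)
        = carrier (relative_homology_group p X B)"
      unfolding peq carrier_relative_homology_group image_image
    proof (intro equalityI subsetI)
      fix z assume "z \<in> (\<lambda>c. hom_induced (int n) ?A ?C X B id (homologous_rel_set n ?A ?C c)) `
        singular_relcycle_set n ?A ?C"
      then show "z \<in> homologous_rel_set n X B ` singular_relcycle_set n X B"
        using img relAX peq by auto
    next
      fix z assume "z \<in> homologous_rel_set n X B ` singular_relcycle_set n X B"
      then obtain c where c: "singular_relcycle n X B c" "z = homologous_rel_set n X B c" by blast
      then obtain a where a: "singular_relcycle n ?A ?C a" "homologous_rel n X B a c"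
        using surj by blast
      then have "z = hom_induced (int n) ?A ?C X B id (homologous_rel_set n ?A ?C a)"
        using img[OF a(1)] c(2) peq homologous_rel_set_eq by metis
      then show "z \<in> (\<lambda>c. hom_induced (int n) ?A ?C X B id (homologous_rel_set n ?A ?C c)) `
        singular_relcycle_set n ?A ?C" using a(1) by blast
    qed
  qed (rule hom_induced_hom)
qed

section \<open>Betti numbers\<close>

lemma finite_zrank_trivial_group:
  assumes "comm_group G" "trivial_group G"
  shows "finite_zrank G (carrier G)" "grank G = 0"
  using zrank_trivial[OF assms(1), of "carrier G"] assms(2)
  by (simp_all add: trivial_group_def grank_eq_zrank)

lemma finite_zrank_integer_group: "finite_zrank integer_group (carrier integer_group)"
proof -
  interpret comm_group integer_group by (rule abelian_integer_group)
  have "card S \<le> card {1::int}" if "zindep integer_group S" for S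
  proof (rule zindep_card_le[OF that])
    fix u :: int
    have "lincomb integer_group {1} (\<lambda>_. u) = u"
      by (simp add: lincomb_def)
    then show "\<exists>n c. n \<noteq> 0 \<and> u [^]\<^bsub>integer_group\<^esub> (n::int) = lincomb integer_group {1} c"
      by (intro exI[of _ "1::int"] exI[of _ "\<lambda>_. u"]) simp
  qed auto
  then show ?thesis unfolding finite_zrank_def by blast
qed

lemma finite_zrank_relative_homology:
  assumes "finite_zrank (homology_group p X) (carrier (homology_group p X))"
    and "finite_zrank (homology_group (p - 1) (subtopology X S)) (carrier (homology_group (p - 1) (subtopology X S)))"
  shows "finite_zrank (relative_homology_group p X S) (carrier (relative_homology_group p X S))"
proof (rule finite_zrank_exact)
  show "kernel (relative_homology_group p X S) (homology_group (p - 1) (subtopology X S)) (hom_boundary p X S)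
      = hom_induced p X {} X S id ` carrier (homology_group p X)"
    using homology_exactness_axiom_1[of p X S] by simp
qed (use assms in \<open>simp_all only: abelian_relative_homology_group hom_induced_hom hom_boundary_hom\<close>)

lemma finite_zrank_homology_from_pair:
  assumes "finite_zrank (homology_group p (subtopology X S)) (carrier (homology_group p (subtopology X S)))"
    and "finite_zrank (relative_homology_group p X S) (carrier (relative_homology_group p X S))"
  shows "finite_zrank (homology_group p X) (carrier (homology_group p X))"
proof (rule finite_zrank_exact)
  show "kernel (homology_group p X) (relative_homology_group p X S) (hom_induced p X {} X S id)
      = hom_induced p (subtopology X S) {} X {} id ` carrier (homology_group p (subtopology X S))"
    using homology_exactness_axiom_3[of p X S] by simp
qed (use assms in \<open>simp_all only: abelian_relative_homology_group hom_induced_hom\<close>)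

lemma finite_zrank_homology_contractible:
  assumes "contractible_space X"
  shows "finite_zrank (homology_group p X) (carrier (homology_group p X))"
proof (cases "topspace X = {}")
  case True
  then show ?thesis
    by (simp add: finite_zrank_trivial_group trivial_homology_group_empty)
next
  case False
  then obtain a where a: "a \<in> topspace X" by blast
  let ?P = "subtopology X {a}"
  have P: "topspace ?P = {a}" using a by auto
  have "trivial_group (relative_homology_group p X {a})"
    by (rule trivial_relative_homology_group_contractible_spaces) (use assms a in auto)
  then have 1: "finite_zrank (relative_homology_group p X {a}) (carrier (relative_homology_group p X {a}))"
    by (simp add: finite_zrank_trivial_group)
  have 2: "finite_zrank (homology_group p ?P) (carrier (homology_group p ?P))"
  proof (cases "p = 0")
    case True
    have "integer_group \<cong> homology_group p ?P"
      using homology_coefficients[OF P] True by (simp add: group.iso_sym)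
    then obtain f where f: "f \<in> iso integer_group (homology_group p ?P)" by (auto simp: is_iso_def)
    show ?thesis
      by (rule grank_iso(1)[OF abelian_integer_group abelian_relative_homology_group f
          finite_zrank_integer_group])
  next
    case False
    then show ?thesis using homology_dimension_axiom[OF P] by (simp add: finite_zrank_trivial_group)
  qed
  show ?thesis by (rule finite_zrank_homology_from_pair[OF 2 1])
qed

text \<open>Removing a closed point \<open>y\<close> changes the homology by that of a pair inside the
  contractible minimal neighbourhood of \<open>y\<close>.\<close>

lemma finite_zrank_homology:
  assumes "finite (topspace X)" "t0_space X"
  shows "finite_zrank (homology_group p X) (carrier (homology_group p X))"
  using assms
proof (induction "card (topspace X)" arbitrary: X p rule: less_induct)
  case less
  note fin = less.prems(1) and t0 = less.prems(2)
  have IH: "finite_zrank (homology_group q (subtopology X S)) (carrier (homology_group q (subtopology X S)))"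
    if "topspace X \<inter> S \<subset> topspace X" for q S
    using that less.hyps[of "subtopology X S" q] fin t0_space_subtopology[OF t0]
    by (simp add: psubset_card_mono)
  show ?case
  proof (cases "topspace X = {}")
    case True
    then show ?thesis by (simp add: finite_zrank_trivial_group trivial_homology_group_empty)
  next
    case False
    then obtain y where y: "y \<in> topspace X" "closedin X {y}"
      using finite_t0_closed_point[OF fin t0] by blast
    let ?M = "min_open X y" and ?W = "topspace X - {y}"
    have M: "openin X ?M" "?M \<subseteq> topspace X"
      using openin_min_open[OF fin] openin_subset by blast+
    have yM: "y \<in> ?M" by (rule mem_min_open[OF y(1)])
    have opW: "openin X ?W" using y by (simp add: closedin_def)
    show ?thesis
    \<comment> \<open>The induction hypothesis covers \<open>?M\<close> only if it is a proper
      subset.\<close>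
    proof (cases "?M = topspace X")
      case True
      then have "contractible_space X"
        using contractible_space_subset_min_open[of y X "topspace X"] y by simp
      then show ?thesis by (rule finite_zrank_homology_contractible)
    next
      case False
      let ?U = "topspace X - ?M"
      have "closedin X ?U" using M by blast
      \<comment> \<open>Here the usual excision theorem suffices: the excised closed set lies in the
        open set \<open>?W\<close>.\<close>
      then have "X closure_of ?U \<subseteq> X interior_of ?W"
        using yM opW by (auto simp: interior_of_openin closure_of_closedin)
      then have "hom_induced p (subtopology X (topspace X - ?U)) (?W - ?U) (subtopology X (topspace X)) ?W id
          \<in> iso (relative_homology_group p (subtopology X (topspace X - ?U)) (?W - ?U))
          (relative_homology_group p (subtopology X (topspace X)) ?W)"
        by (rule homology_excision_axiom) auto
      moreover have "topspace X - ?U = ?M" "?W - ?U = ?M - {y}" using M yM by auto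
      ultimately have iso: "hom_induced p (subtopology X ?M) (?M - {y}) X ?W id
          \<in> iso (relative_homology_group p (subtopology X ?M) (?M - {y})) (relative_homology_group p X ?W)"
        by simp
      have sub: "subtopology (subtopology X ?M) (?M - {y}) = subtopology X (?M - {y})"
        by (simp add: subtopology_subtopology Int_absorb1)
      have "topspace X \<inter> ?M \<subset> topspace X" "topspace X \<inter> (?M - {y}) \<subset> topspace X"
        using False M y by auto
      note finM = this[THEN IH]
      have "finite_zrank (relative_homology_group p (subtopology X ?M) (?M - {y}))
          (carrier (relative_homology_group p (subtopology X ?M) (?M - {y})))"
        by (rule finite_zrank_relative_homology[OF finM(1), of _ "?M - {y}", unfolded sub, OF finM(2)])
      then have "finite_zrank (relative_homology_group p X ?W) (carrier (relative_homology_group p X ?W))"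
        using grank_iso(1)[OF _ _ iso] by simp
      moreover have "finite_zrank (homology_group p (subtopology X ?W)) (carrier (homology_group p (subtopology X ?W)))"
        by (rule IH) (use y in auto)
      ultimately show ?thesis using finite_zrank_homology_from_pair by blast
    qed
  qed
qed

section \<open>Alternating sums along the long exact sequence of a pair\<close>

definition alt_sum :: "(nat \<Rightarrow> nat) \<Rightarrow> nat \<Rightarrow> int" where
  "alt_sum f k = (\<Sum>j\<le>k. (-1) ^ (k - j) * int (f j))"

lemma alt_sum_0 [simp]: "alt_sum f 0 = int (f 0)"
  by (simp add: alt_sum_def)

lemma alt_sum_Suc [simp]: "alt_sum f (Suc k) = int (f (Suc k)) - alt_sum f k"
proof -
  have "(\<Sum>j\<le>k. (-1) ^ (Suc k - j) * int (f j)) = (\<Sum>j\<le>k. - ((-1) ^ (k - j) * int (f j)))"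
    by (intro sum.cong) (auto simp: Suc_diff_le)
  then show ?thesis by (simp add: alt_sum_def sum_negf)
qed

text \<open>\<open>b\<close>, \<open>r\<close> and \<open>x\<close> stand for the ranks of the
  subspace, the pair and the space, \<open>d j\<close> for the rank of the connecting map out of
  degree \<open>j\<close>. The sum telescopes and only the last connecting rank survives; that it is
  nonnegative is the source of the strong inequalities.\<close>

lemma alt_sum_exact:
  assumes "\<And>j. b j + r j = x j + (d (Suc j) + d j)" "d 0 = 0"
  shows "alt_sum b k + alt_sum r k = alt_sum x k + int (d (Suc k))"
proof (induction k)
  case 0
  then show ?case using assms(1)[of 0] assms(2) by simp
next
  case (Suc k)
  have "int (b (Suc k)) + int (r (Suc k)) = int (x (Suc k)) + (int (d (Suc (Suc k))) + int (d (Suc k)))"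
    using assms(1)[of "Suc k"] by (metis of_nat_add)
  with Suc show ?case by simp
qed

lemma alt_sum_rank_pair:
  assumes X: "\<And>p. finite_zrank (homology_group p X) (carrier (homology_group p X))"
    and S: "\<And>p. finite_zrank (homology_group p (subtopology X S)) (carrier (homology_group p (subtopology X S)))"
  shows "alt_sum (\<lambda>j. grank (homology_group (int j) X)) k
      \<le> alt_sum (\<lambda>j. grank (homology_group (int j) (subtopology X S))) k
        + alt_sum (\<lambda>j. grank (relative_homology_group (int j) X S)) k"
proof -
  let ?HX = "\<lambda>p. homology_group p X" and ?HS = "\<lambda>p. homology_group p (subtopology X S)"
    and ?R = "\<lambda>p. relative_homology_group p X S"
  let ?i = "\<lambda>p. hom_induced p (subtopology X S) {} X {} id"
    and ?j = "\<lambda>p. hom_induced p X {} X S id" and ?bd = "\<lambda>p. hom_boundary p X S"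
  \<comment> \<open>The integer degree \<open>int j - 1\<close> also covers \<open>j = 0\<close>,
    where the target is trivial and \<open>d 0 = 0\<close>.\<close>
  define d where "d j = zrank (?HS (int j - 1)) (?bd (int j) ` carrier (?R (int j)))" for j
  have R: "finite_zrank (?R p) (carrier (?R p))" for p
    using finite_zrank_relative_homology[OF X S] .
  have "grank (?HS (int j)) + grank (?R (int j)) = grank (?HX (int j)) + (d (Suc j) + d j)" for j
  proof -
    have 1: "kernel (?R (int j)) (?HS (int j - 1)) (?bd (int j)) = ?j (int j) ` carrier (?HX (int j))"
      using homology_exactness_axiom_1[of "int j" X S] by simp
    have 2: "kernel (?HS (int j)) (?HX (int j)) (?i (int j)) = ?bd (int (Suc j)) ` carrier (?R (int (Suc j)))"
      using homology_exactness_axiom_2[of "int (Suc j)" X S] by simp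
    have 3: "kernel (?HX (int j)) (?R (int j)) (?j (int j)) = ?i (int j) ` carrier (?HS (int j))"
      using homology_exactness_axiom_3[of "int j" X S] by simp
    have "grank (?HS (int j)) = d (Suc j) + zrank (?HX (int j)) (?i (int j) ` carrier (?HS (int j)))"
      using rank_nullity[OF abelian_relative_homology_group abelian_relative_homology_group hom_induced_hom S, of "int j" X "{}" id] by (simp add: 2 d_def)
    moreover have "grank (?HX (int j)) = zrank (?HX (int j)) (?i (int j) ` carrier (?HS (int j)))
        + zrank (?R (int j)) (?j (int j) ` carrier (?HX (int j)))"
      using rank_nullity[OF abelian_relative_homology_group abelian_relative_homology_group hom_induced_hom X, of "int j" X S id] by (simp add: 3)
    moreover have "grank (?R (int j)) = zrank (?R (int j)) (?j (int j) ` carrier (?HX (int j))) + d j"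
      using rank_nullity[OF abelian_relative_homology_group abelian_relative_homology_group hom_boundary_hom R, of "int j"] by (simp add: 1 d_def)
    ultimately show ?thesis by simp
  qed
  moreover have "d 0 = 0"
  proof -
    have "trivial_group (?HS (-1))" by simp
    moreover have "?bd 0 ` carrier (?R 0) \<subseteq> carrier (?HS (-1))"
      using hom_boundary_carrier[of 0 X S] by auto
    ultimately have "?bd 0 ` carrier (?R 0) \<subseteq> {\<one>\<^bsub>?HS (-1)\<^esub>}"
      by (simp add: trivial_group_def)
    then show ?thesis unfolding d_def by (simp add: zrank_trivial(2))
  qed
  ultimately show ?thesis
    using alt_sum_exact[of "\<lambda>j. grank (?HS (int j))" "\<lambda>j. grank (?R (int j))" "\<lambda>j. grank (?HX (int j))" d k]
    by simp
qed

section \<open>Homology of closed sets and of their differences\<close>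

lemma relhom_closed:
  assumes "closedin T N"
  shows "relhom T N p = homology_group p (subtopology T N)"
  using assms by (simp add: relhom_def mo_def closure_of_closedin)

text \<open>Within \<open>N\<close>, \<open>closed_excision\<close> is applied to the closure of
  \<open>M\<close> and to \<open>N'\<close>, whose intersection is \<open>mo T M\<close>.\<close>

lemma relhom_Diff_closed_iso:
  assumes fin: "finite (topspace T)" and t0: "t0_space T"
    and N: "closedin T N" "closedin T N'" "N' \<subseteq> N" and M: "M = N - N'"
  shows "\<exists>f. f \<in> iso (relhom T M p) (relative_homology_group p (subtopology T N) N')"
proof -
  let ?X = "subtopology T N" and ?A = "T closure_of M"
  have NT: "N \<subseteq> topspace T" using N(1) closedin_subset by blast
  have MA: "M \<subseteq> ?A" using M NT by (intro closure_of_subset) auto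
  have AN: "?A \<subseteq> N" using M N(1) by (intro closure_of_minimal) auto
  have X: "topspace ?X = N" using NT by auto
  have cov: "topspace ?X \<subseteq> ?A \<union> N'" unfolding X using MA M by auto
  have cA: "closedin ?X ?A" using AN by (simp add: closedin_closed_subtopology[OF N(1)])
  have cN: "closedin ?X N'" using N by (simp add: closedin_closed_subtopology[OF N(1)])
  have fX: "finite (topspace ?X)" using fin by simp
  have eq: "?A \<inter> N' = mo T M" using MA AN M by (auto simp: mo_def)
  have "subtopology ?X ?A = subtopology T ?A"
    using AN by (simp add: subtopology_subtopology Int_absorb1)
  then show ?thesis
    using closed_excision[OF fX t0_space_subtopology[OF t0] cA cN cov, of p] eq
    unfolding relhom_def by auto
qed

lemma alt_sum_betti_Diff_closed:
  assumes fin: "finite (topspace T)" and t0: "t0_space T"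
    and N: "closedin T N" "closedin T N'" "N' \<subseteq> N"
  shows "alt_sum (betti T N) k \<le> alt_sum (betti T N') k + alt_sum (betti T (N - N')) k"
proof -
  let ?X = "subtopology T N"
  have sub: "subtopology ?X N' = subtopology T N'"
    using N(3) by (simp add: subtopology_subtopology Int_absorb1)
  have fX: "finite (topspace ?X)" "t0_space ?X" using fin t0_space_subtopology[OF t0] by auto
  have fS: "finite (topspace (subtopology ?X N'))" "t0_space (subtopology ?X N')"
    using fX t0_space_subtopology by auto
  have "grank (relative_homology_group (int j) ?X N') = betti T (N - N') j" for j
  proof -
    obtain f where f: "f \<in> iso (relhom T (N - N') (int j)) (relative_homology_group (int j) ?X N')"
      using relhom_Diff_closed_iso[OF fin t0 N refl] by blast
    have cg: "comm_group (relhom T (N - N') (int j))" by (simp add: relhom_def)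
    \<comment> \<open>\<open>grank_iso\<close> asks for finite rank of its source, which is
      available for the pair; hence the inverse isomorphism.\<close>
    have inv: "inv_into (carrier (relhom T (N - N') (int j))) f
        \<in> iso (relative_homology_group (int j) ?X N') (relhom T (N - N') (int j))"
      using f group.iso_set_sym[of "relhom T (N - N') (int j)"] by (simp add: relhom_def)
    show ?thesis unfolding betti_def
      by (rule grank_iso(2)[OF abelian_relative_homology_group cg inv, symmetric],
          rule finite_zrank_relative_homology[OF finite_zrank_homology[OF fX] finite_zrank_homology[OF fS]])
  qed
  moreover have "betti T N j = grank (homology_group (int j) ?X)"
    "betti T N' j = grank (homology_group (int j) (subtopology ?X N'))" for j
    by (simp_all only: betti_def relhom_closed[OF N(1)] relhom_closed[OF N(2)] sub)
  ultimately show ?thesis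
    using alt_sum_rank_pair[of ?X N' k, OF finite_zrank_homology[OF fX] finite_zrank_homology[OF fS]]
    by (simp add: alt_sum_def)
qed

lemma betti_regular: "regular T A \<Longrightarrow> betti T A k = 0"
  unfolding regular_def critical_def betti_def
  by (auto intro!: finite_zrank_trivial_group(2) simp: relhom_def)

lemma betti_empty: "betti T {} k = 0"
  unfolding betti_def
  by (auto intro!: finite_zrank_trivial_group(2) trivial_relative_homology_group_empty simp: relhom_def)

section \<open>Dynamics of multivector fields\<close>

locale mv_space =
  fixes T :: "'a topology" and V :: "'a set set"
  assumes finite_space: "finite (topspace T)" and t0: "t0_space T" and mv: "mvfield T V"
begin

lemma cell_eq: "A \<in> V \<Longrightarrow> x \<in> A \<Longrightarrow> cell V x = A"
  unfolding cell_def using mv unfolding mvfield_def by (intro the_equality) blast+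

lemma cell_in: "x \<in> topspace T \<Longrightarrow> cell V x \<in> V \<and> x \<in> cell V x"
  using mv cell_eq unfolding mvfield_def by (metis UnionE)

lemma cell_subset: "x \<in> topspace T \<Longrightarrow> cell V x \<subseteq> topspace T"
  using cell_in[of x] mv by (auto simp: mvfield_def)

lemma Pi_V_subset: "x \<in> topspace T \<Longrightarrow> Pi_V T V x \<subseteq> topspace T"
  unfolding Pi_V_def using cell_subset closure_of_subset_topspace by (metis Un_least)

lemma Pi_V_refl: "x \<in> topspace T \<Longrightarrow> x \<in> Pi_V T V x"
  using cell_in[of x] by (simp add: Pi_V_def)

definition step :: "('a \<times> 'a) set" where
  "step = {(x, y). x \<in> topspace T \<and> y \<in> Pi_V T V x}"

lemma step_topspace: "(x, y) \<in> step \<Longrightarrow> x \<in> topspace T \<and> y \<in> topspace T"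
  using Pi_V_subset by (auto simp: step_def)

lemma full_solution_iff_step:
  "full_solution T V (topspace T) \<phi> \<longleftrightarrow> (\<forall>t. (\<phi> t, \<phi> (t + 1)) \<in> step)"
  by (auto simp: full_solution_def step_def)

lemma step_cell_sym: "x \<in> topspace T \<Longrightarrow> y \<in> cell V x \<Longrightarrow> (y, x) \<in> step"
  using cell_in[of x] cell_eq[of "cell V x" y] cell_subset[of x] by (auto simp: step_def Pi_V_def)

text \<open>In a finite space the closure of a set is the union of the closures of its points, and
  \<open>Pi_V T V x\<close> contains the closure of \<open>x\<close>.\<close>

lemma forward_closed_imp_closedin:
  assumes "N \<subseteq> topspace T" "\<And>x. x \<in> N \<Longrightarrow> Pi_V T V x \<subseteq> N"
  shows "closedin T N"
proof -
  have "T closure_of N \<subseteq> N"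
  proof
    fix x assume x: "x \<in> T closure_of N"
    then have xT: "x \<in> topspace T" by (simp add: in_closure_of)
    have "x \<in> min_open T x \<and> openin T (min_open T x)"
      using mem_min_open[OF xT] openin_min_open[OF finite_space] by blast
    then obtain z where z: "z \<in> N" "z \<in> min_open T x"
      using x unfolding in_closure_of by blast
    have "x \<in> T closure_of {z}"
      using xT z(2) min_open_subset by (fastforce simp: in_closure_of)
    then show "x \<in> N" using assms(2)[OF z(1)] by (auto simp: Pi_V_def)
  qed
  then show ?thesis using assms(1) closure_of_subset_eq by blast
qed

text \<open>One half of an essential solution; \<open>R\<close> is \<open>step\<close> or its
  converse, so both time directions share the notion. The last clause ranges over all regular
  multivectors, visited or not, and thus depends on the tail only.\<close>

definition ray :: "('a \<times> 'a) set \<Rightarrow> 'a set \<Rightarrow> (nat \<Rightarrow> 'a) \<Rightarrow> bool" where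
  "ray R B \<psi> \<longleftrightarrow> (\<forall>i. (\<psi> i, \<psi> (Suc i)) \<in> R) \<and> (\<exists>s. \<forall>i\<ge>s. \<psi> i \<in> B) \<and>
     (\<forall>C\<in>V. regular T C \<longrightarrow> (\<forall>n. \<exists>i\<ge>n. \<psi> i \<notin> C))"

lemma ray_Cons:
  assumes "ray R B \<psi>" "(x, \<psi> 0) \<in> R"
  shows "ray R B (case_nat x \<psi>)"
  unfolding ray_def
proof (intro conjI allI ballI impI)
  show "(case_nat x \<psi> i, case_nat x \<psi> (Suc i)) \<in> R" for i
    using assms by (cases i) (auto simp: ray_def)
  obtain s where "\<forall>i\<ge>s. \<psi> i \<in> B" using assms(1) by (auto simp: ray_def)
  then have "\<forall>i\<ge>Suc s. case_nat x \<psi> i \<in> B" by (auto split: nat.split)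
  then show "\<exists>s. \<forall>i\<ge>s. case_nat x \<psi> i \<in> B" by blast
  fix C n assume "C \<in> V" "regular T C"
  then obtain i where "i \<ge> n" "\<psi> i \<notin> C" using assms(1) unfolding ray_def by blast
  then show "\<exists>i\<ge>n. case_nat x \<psi> i \<notin> C" by (intro exI[of _ "Suc i"]) auto
qed

text \<open>A finite path in front does not affect the tail. This lets solutions inside a Morse set
  be continued along arbitrary paths.\<close>

lemma ray_rtrancl:
  assumes "(x, y) \<in> R\<^sup>*" "\<exists>\<psi>. ray R B \<psi> \<and> \<psi> 0 = y"
  shows "\<exists>\<psi>. ray R B \<psi> \<and> \<psi> 0 = x"
  using assms
proof (induction rule: converse_rtrancl_induct)
  case (step a b)
  then obtain \<psi> where "ray R B \<psi>" "\<psi> 0 = b" by blast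
  with step.hyps(1) show ?case by (intro exI[of _ "case_nat a \<psi>"]) (simp add: ray_Cons)
qed

lemma invariant_rays:
  assumes "invariant T V A" "A \<subseteq> topspace T" "x \<in> A"
  shows "\<exists>\<psi>. ray step A \<psi> \<and> \<psi> 0 = x" "\<exists>\<psi>. ray (step\<inverse>) A \<psi> \<and> \<psi> 0 = x"
proof -
  obtain \<phi> where \<phi>: "full_solution T V A \<phi>" "essential T V \<phi>" "\<phi> 0 = x"
    using assms unfolding invariant_def Inv_def by blast
  have A: "\<phi> i \<in> A" "\<phi> i \<in> topspace T" and Pi: "\<phi> (i + 1) \<in> Pi_V T V (\<phi> i)" for i
    using \<phi>(1) assms(2) by (auto simp: full_solution_def)
  \<comment> \<open>Essentiality constrains only multivectors that are visited; for one that is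
    never visited the claim is immediate.\<close>
  have ess: "(\<exists>s\<le>n. \<phi> s \<notin> C) \<and> (\<exists>s\<ge>n. \<phi> s \<notin> C)" if C: "C \<in> V" "regular T C" for C n
  proof (cases "\<exists>t. \<phi> t \<in> C")
    case True
    then obtain t where "cell V (\<phi> t) = C" using cell_eq C(1) by blast
    then show ?thesis using \<phi>(2) C(2) unfolding essential_def by metis
  qed auto
  show "\<exists>\<psi>. ray step A \<psi> \<and> \<psi> 0 = x"
  proof (intro exI[of _ "\<lambda>i. \<phi> (int i)"] conjI)
    show "ray step A (\<lambda>i. \<phi> (int i))"
      unfolding ray_def
    proof (intro conjI allI ballI impI)
      show "(\<phi> (int i), \<phi> (int (Suc i))) \<in> step" for i
        using A Pi[of "int i"] by (simp add: step_def add.commute)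
      fix C n assume "C \<in> V" "regular T C"
      then obtain s where "s \<ge> int n" "\<phi> s \<notin> C" using ess by blast
      then show "\<exists>i\<ge>n. \<phi> (int i) \<notin> C" by (intro exI[of _ "nat s"]) auto
    qed (use A in auto)
  qed (use \<phi> in simp)
  show "\<exists>\<psi>. ray (step\<inverse>) A \<psi> \<and> \<psi> 0 = x"
  proof (intro exI[of _ "\<lambda>i. \<phi> (- int i)"] conjI)
    show "ray (step\<inverse>) A (\<lambda>i. \<phi> (- int i))"
      unfolding ray_def
    proof (intro conjI allI ballI impI)
      show "(\<phi> (- int i), \<phi> (- int (Suc i))) \<in> step\<inverse>" for i
        using A Pi[of "- int (Suc i)"] by (simp add: step_def)
      fix C n assume "C \<in> V" "regular T C"
      then obtain s where "s \<le> - int n" "\<phi> s \<notin> C" using ess by blast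
      then show "\<exists>i\<ge>n. \<phi> (- int i) \<notin> C" by (intro exI[of _ "nat (- s)"]) auto
    qed (use A in auto)
  qed (use \<phi> in simp)
qed

text \<open>Being an essential solution is a matter of single steps and of the two tails, so a
  backward and a forward ray from \<open>x\<close> fit together.\<close>

lemma glue_rays:
  assumes b: "ray (step\<inverse>) A \<psi>" and f: "ray step B \<psi>'" and eq: "\<psi> 0 = x" "\<psi>' 0 = x"
  obtains \<phi> where "full_solution T V (topspace T) \<phi>" "essential T V \<phi>" "\<phi> 0 = x"
    "\<exists>s. \<forall>t\<le>s. \<phi> t \<in> A" "\<exists>s. \<forall>t\<ge>s. \<phi> t \<in> B"
proof -
  define \<phi> where "\<phi> t = (if t \<ge> 0 then \<psi>' (nat t) else \<psi> (nat (- t)))" for t :: int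
  have neg: "\<phi> (- int i) = \<psi> i" and pos: "\<phi> (int i) = \<psi>' i" for i
    using eq by (auto simp: \<phi>_def)
  have st: "(\<phi> t, \<phi> (t + 1)) \<in> step" for t
  proof (cases "t \<ge> 0")
    case True
    then obtain i where i: "t = int i" using nonneg_int_cases by blast
    then have "\<phi> (t + 1) = \<psi>' (Suc i)" using pos[of "Suc i"] by (simp add: add.commute)
    then show ?thesis using f pos[of i] i by (simp add: ray_def)
  next
    case False
    then obtain i where i: "t = - int (Suc i)" by (metis int_cases not_le int_nat_eq negative_zle of_nat_0_le_iff)
    then have "\<phi> (t + 1) = \<psi> i" using neg[of i] by simp
    then show ?thesis using b neg[of "Suc i"] i by (simp add: ray_def)
  qed
  show thesis
  proof
    show "full_solution T V (topspace T) \<phi>"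
      using st by (simp add: full_solution_iff_step)
    show "essential T V \<phi>"
      unfolding essential_def
    proof (intro allI impI)
      fix t assume reg: "regular T (cell V (\<phi> t))"
      have "cell V (\<phi> t) \<in> V" using st step_topspace cell_in by blast
      then have e: "\<And>n. \<exists>i\<ge>n. \<psi> i \<notin> cell V (\<phi> t)" "\<And>n. \<exists>i\<ge>n. \<psi>' i \<notin> cell V (\<phi> t)"
        using reg b f by (auto simp: ray_def)
      show "(\<forall>n. \<exists>s\<le>n. \<phi> s \<notin> cell V (\<phi> t)) \<and> (\<forall>n. \<exists>s\<ge>n. \<phi> s \<notin> cell V (\<phi> t))"
      proof (intro conjI allI)
        fix n :: int
        obtain i where i: "i \<ge> nat (- n)" "\<psi> i \<notin> cell V (\<phi> t)" using e(1) by blast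
        then show "\<exists>s\<le>n. \<phi> s \<notin> cell V (\<phi> t)"
          using neg[of i] by (intro exI[of _ "- int i"]) auto
        obtain j where j: "j \<ge> nat n" "\<psi>' j \<notin> cell V (\<phi> t)" using e(2) by blast
        then show "\<exists>s\<ge>n. \<phi> s \<notin> cell V (\<phi> t)"
          using pos[of j] by (intro exI[of _ "int j"]) auto
      qed
    qed
    show "\<phi> 0 = x" using pos[of 0] eq by simp
    obtain s where s: "\<forall>i\<ge>s. \<psi> i \<in> A" using b by (auto simp: ray_def)
    have "\<phi> t \<in> A" if "t \<le> - int s" for t
      using s neg[of "nat (- t)"] that by (auto dest: spec[of _ "nat (- t)"])
    then show "\<exists>s. \<forall>t\<le>s. \<phi> t \<in> A" by blast
    obtain s where s: "\<forall>i\<ge>s. \<psi>' i \<in> B" using f by (auto simp: ray_def)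
    have "\<phi> t \<in> B" if "t \<ge> int s" for t
      using s pos[of "nat t"] that by (auto dest: spec[of _ "nat t"])
    then show "\<exists>s. \<forall>t\<ge>s. \<phi> t \<in> B" by blast
  qed
qed

text \<open>By finiteness some point is visited at infinitely many nonpositive times. Nonemptiness
  is what lets a limit set determine the Morse set that contains it.\<close>

lemma uim_minus_nonempty:
  assumes "full_solution T V (topspace T) \<phi>"
  shows "uim_minus \<phi> \<noteq> {}"
proof -
  have "finite (\<phi> ` {..0})"
    using assms finite_space by (auto simp: full_solution_def intro: finite_subset)
  moreover have "infinite {..0::int}" by (simp add: infinite_Iic)
  ultimately obtain y where y: "infinite (\<phi> -` {y} \<inter> {..0})"
    using inf_img_fin_dom' by blast
  have "y \<in> \<phi> ` {..t}" for t
  proof (rule ccontr)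
    assume "y \<notin> \<phi> ` {..t}"
    then have "\<phi> -` {y} \<inter> {..0} \<subseteq> {t<..0}" by force
    then show False using y finite_subset by blast
  qed
  then show ?thesis unfolding uim_minus_def by blast
qed

lemma uim_plus_nonempty:
  assumes "full_solution T V (topspace T) \<phi>"
  shows "uim_plus \<phi> \<noteq> {}"
proof -
  have "finite (\<phi> ` {0..})"
    using assms finite_space by (auto simp: full_solution_def intro: finite_subset)
  moreover have "infinite {0::int..}" by (simp add: infinite_Ici)
  ultimately obtain y where y: "infinite (\<phi> -` {y} \<inter> {0..})"
    using inf_img_fin_dom' by blast
  have "y \<in> \<phi> ` {t..}" for t
  proof (rule ccontr)
    assume "y \<notin> \<phi> ` {t..}"
    then have "\<phi> -` {y} \<inter> {0..} \<subseteq> {0..<t}" by force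
    then show False using y finite_subset by blast
  qed
  then show ?thesis unfolding uim_plus_def by blast
qed

lemma uim_minus_subset: "\<forall>t\<le>s. \<phi> t \<in> A \<Longrightarrow> uim_minus \<phi> \<subseteq> A"
  unfolding uim_minus_def by (force intro: min.cobounded1 min.cobounded2 dest: bspec[of _ _ "min s 0"])

lemma uim_plus_subset: "\<forall>t\<ge>s. \<phi> t \<in> A \<Longrightarrow> uim_plus \<phi> \<subseteq> A"
  unfolding uim_plus_def by (force dest: bspec[of _ _ "max s 0"])

lemma vhull_superset: "A \<subseteq> vhull T V A"
  unfolding vhull_def by blast

end

section \<open>Essential solutions and Morse sets\<close>

locale morse_space = mv_space T V for T :: "'a topology" and V :: "'a set set" +
  fixes P :: "'p set" and leq :: "'p \<Rightarrow> 'p \<Rightarrow> bool" and M :: "'p \<Rightarrow> 'a set"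
  assumes morse: "morse_decomposition T V P leq M"
begin

lemma finite_P: "finite P"
  and leq_antisym: "\<lbrakk>p \<in> P; q \<in> P; leq p q; leq q p\<rbrakk> \<Longrightarrow> p = q"
  and leq_trans: "\<lbrakk>p \<in> P; q \<in> P; r \<in> P; leq p q; leq q r\<rbrakk> \<Longrightarrow> leq p r"
  and M_subset: "p \<in> P \<Longrightarrow> M p \<subseteq> topspace T"
  and M_invariant: "p \<in> P \<Longrightarrow> invariant T V (M p)"
  and M_disjoint: "\<lbrakk>p \<in> P; q \<in> P; x \<in> M p; x \<in> M q\<rbrakk> \<Longrightarrow> p = q"
  using morse unfolding morse_decomposition_def isolated_invariant_def by blast+

lemma essential_cases:
  assumes "full_solution T V (topspace T) \<phi>" "essential T V \<phi>"
  obtains (inside) r where "r \<in> P" "range \<phi> \<subseteq> M r"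
  | (connecting) p q where "p \<in> P" "q \<in> P" "leq p q" "p \<noteq> q"
      "uim_minus \<phi> \<subseteq> M q" "uim_plus \<phi> \<subseteq> M p"
  using morse assms vhull_superset unfolding morse_decomposition_def alpha_lim_def omega_lim_def
  by (meson subset_trans)

lemma recurrent_in_Morse_set:
  assumes "full_solution T V (topspace T) \<phi>" "essential T V \<phi>" "x \<in> uim_minus \<phi>"
  shows "\<exists>p\<in>P. x \<in> M p"
  using assms(1,2)
proof (cases rule: essential_cases)
  case (inside r)
  have "x \<in> \<phi> ` {..0}" using assms(3) unfolding uim_minus_def by (rule INT_D) simp
  then show ?thesis using inside by blast
qed (use assms(3) in blast)

text \<open>The path is continued backward inside \<open>M q\<close> and forward inside
  \<open>M p\<close> to an essential solution through \<open>x\<close>. Its limit sets are nonempty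
  and lie in \<open>M q\<close> and \<open>M p\<close>, so disjointness identifies the Morse sets
  that the decomposition supplies.\<close>

lemma connecting_path:
  assumes pq: "p \<in> P" "q \<in> P" and ab: "a \<in> M q" "b \<in> M p"
    and path: "(a, x) \<in> step\<^sup>*" "(x, b) \<in> step\<^sup>*"
  shows "(p = q \<and> x \<in> M p) \<or> (p \<noteq> q \<and> leq p q)"
proof -
  have "\<exists>\<psi>. ray (step\<inverse>) (M q) \<psi> \<and> \<psi> 0 = x"
    using path(1) invariant_rays(2)[OF M_invariant M_subset ab(1)] pq
    by (intro ray_rtrancl[of x a]) (auto simp: rtrancl_converse)
  moreover have "\<exists>\<psi>. ray step (M p) \<psi> \<and> \<psi> 0 = x"
    using invariant_rays(1)[OF M_invariant M_subset ab(2)] pq by (intro ray_rtrancl[OF path(2)]) auto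
  ultimately obtain \<phi> s s' where \<phi>: "full_solution T V (topspace T) \<phi>" "essential T V \<phi>" "\<phi> 0 = x"
    and s: "\<forall>t\<le>s. \<phi> t \<in> M q" and s': "\<forall>t\<ge>s'. \<phi> t \<in> M p"
    using glue_rays by metis
  show ?thesis using \<phi>(1,2)
  proof (cases rule: essential_cases)
    case (inside r)
    then have "\<phi> s \<in> M r" "\<phi> s' \<in> M r" "x \<in> M r" using \<phi>(3) by auto
    moreover have "\<phi> s \<in> M q" "\<phi> s' \<in> M p" using s s' by auto
    ultimately show ?thesis using M_disjoint inside pq by metis
  next
    case (connecting p' q')
    have "q = q'" "p = p'"
      using uim_minus_nonempty[OF \<phi>(1)] uim_minus_subset[OF s] connecting
        uim_plus_nonempty[OF \<phi>(1)] uim_plus_subset[OF s'] pq M_disjoint by blast+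
    then show ?thesis using connecting by blast
  qed
qed

text \<open>Resting at a point of a critical multivector is an essential solution, and the point
  belongs to its limit set.\<close>

lemma regular_outside_Morse_sets:
  assumes x: "x \<in> topspace T" and out: "\<And>p. p \<in> P \<Longrightarrow> x \<notin> M p"
  shows "regular T (cell V x)"
proof (rule ccontr)
  assume crit: "\<not> regular T (cell V x)"
  have "full_solution T V (topspace T) (\<lambda>_. x)"
    using x Pi_V_refl by (simp add: full_solution_def)
  moreover have "essential T V (\<lambda>_. x)" using crit by (simp add: essential_def)
  moreover have "x \<in> uim_minus (\<lambda>_. x)" by (auto simp: uim_minus_def)
  ultimately show False using recurrent_in_Morse_set out by blast
qed

text \<open>Otherwise running around the loop periodically would be an essential solution, since it
  keeps leaving every multivector.\<close>

lemma loop_outside_Morse_sets: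
  assumes x: "x \<in> topspace T" and out: "\<And>p. p \<in> P \<Longrightarrow> x \<notin> M p"
    and loop: "(x, y) \<in> step\<^sup>*" "(y, x) \<in> step\<^sup>*"
  shows "y \<in> cell V x"
proof (rule ccontr)
  assume y: "y \<notin> cell V x"
  obtain m f where f: "f 0 = x" "f m = y" "\<And>i. i < m \<Longrightarrow> (f i, f (Suc i)) \<in> step"
    using loop(1) by (metis rtrancl_imp_relpow relpow_fun_conv)
  obtain n g where g: "g 0 = y" "g n = x" "\<And>i. i < n \<Longrightarrow> (g i, g (Suc i)) \<in> step"
    using loop(2) by (metis rtrancl_imp_relpow relpow_fun_conv)
  have "x \<noteq> y" using y cell_in[OF x] by blast
  then have pos: "m > 0" "n > 0" using f(1,2) g(1,2) by (metis gr0I)+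
  \<comment> \<open>One period: from \<open>x\<close> to \<open>y\<close> along \<open>f\<close> and
    back along \<open>g\<close>; the two agree at time \<open>m\<close>.\<close>
  define h where "h i = (if i \<le> m then f i else g (i - m))" for i
  have h: "h 0 = x" "h m = y" "h (m + n) = x" using f g pos by (auto simp: h_def)
  have hstep: "(h i, h (Suc i)) \<in> step" if "i < m + n" for i
  proof (cases "i < m")
    case True
    then show ?thesis using f(3) by (simp add: h_def)
  next
    case False
    have "h i = g (i - m)" using False f(2) g(1) by (auto simp: h_def)
    moreover have "h (Suc i) = g (Suc (i - m))" using False by (simp add: h_def Suc_diff_le)
    ultimately show ?thesis using g(3)[of "i - m"] False that by simp
  qed
  define N where "N = int (m + n)"
  have N: "N > 0" using pos by (simp add: N_def)
  define \<phi> where "\<phi> t = h (nat (t mod N))" for t :: int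
  have \<phi>step: "(\<phi> t, \<phi> (t + 1)) \<in> step" for t
  proof -
    let ?r = "t mod N"
    have r: "0 \<le> ?r" "?r < N" using N by simp_all
    then have "(h (nat ?r), h (Suc (nat ?r))) \<in> step" by (intro hstep) (simp add: N_def nat_less_iff)
    moreover have "\<phi> (t + 1) = h (Suc (nat ?r))"
    proof (cases "?r + 1 = N")
      case True
      then have "(t + 1) mod N = 0" by (metis mod_add_left_eq mod_self)
      moreover have "Suc (nat ?r) = m + n" using True r by (simp add: N_def)
      ultimately show ?thesis using h by (simp add: \<phi>_def)
    next
      case False
      then have "(t + 1) mod N = ?r + 1" using r by (metis mod_add_left_eq mod_pos_pos_trivial add_nonneg_nonneg zero_le_one zless_imp_add1_zle order_less_le)
      then show ?thesis using r by (simp add: \<phi>_def nat_add_distrib)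
    qed
    ultimately show ?thesis by (simp add: \<phi>_def)
  qed
  have \<phi>x: "\<phi> (k * N) = x" for k using h by (simp add: \<phi>_def)
  have \<phi>y: "\<phi> (k * N + int m) = y" for k
  proof -
    have "(k * N + int m) mod N = int m" using pos by (simp add: N_def)
    then show ?thesis using h by (simp add: \<phi>_def)
  qed
  \<comment> \<open>As \<open>N\<close> is at least 1, multiplying a nonpositive number by it does
    not increase the number. The witness places visits to \<open>x\<close> and to \<open>y\<close>
    before any given time.\<close>
  have low: "\<exists>k. k * N \<le> t \<and> k * N + int m \<le> t" for t
  proof -
    have "(- \<bar>t - int m\<bar>) * N \<le> - \<bar>t - int m\<bar>" using N by (simp add: mult_le_cancel_left1)
    then show ?thesis by (intro exI[of _ "- \<bar>t - int m\<bar>"]) linarith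
  qed
  have high: "\<exists>k. k * N \<ge> t \<and> k * N + int m \<ge> t" for t
  proof -
    have "\<bar>t\<bar> * N \<ge> \<bar>t\<bar>" using N by (simp add: mult_le_cancel_left1)
    then show ?thesis by (intro exI[of _ "\<bar>t\<bar>"]) linarith
  qed
  have full: "full_solution T V (topspace T) \<phi>"
    using \<phi>step by (simp add: full_solution_iff_step)
  have "essential T V \<phi>"
    unfolding essential_def
  proof (intro allI impI conjI)
    fix t n
    have "cell V (\<phi> t) \<in> V" using \<phi>step step_topspace cell_in by blast
    \<comment> \<open>No multivector contains both \<open>x\<close> and \<open>y\<close>, so one of
      these two recurring points always lies outside.\<close>
    then have out: "x \<notin> cell V (\<phi> t) \<or> y \<notin> cell V (\<phi> t)" using cell_eq y by metis
    show "\<exists>s\<le>n. \<phi> s \<notin> cell V (\<phi> t)"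
      using low[of n] out \<phi>x \<phi>y by metis
    show "\<exists>s\<ge>n. \<phi> s \<notin> cell V (\<phi> t)"
      using high[of n] out \<phi>x \<phi>y by metis
  qed
  moreover have "x \<in> \<phi> ` {..t}" for t
    using low[of t] \<phi>x by (metis atMost_iff image_eqI)
  then have "x \<in> uim_minus \<phi>" unfolding uim_minus_def by blast
  ultimately show False using recurrent_in_Morse_set[OF full] out by blast
qed

text \<open>Stated for general \<open>N\<close> so that induction on its size can remove one piece
  at a time. The last assumption guarantees that no Morse set is cut along the way.\<close>

lemma alt_sum_betti_forward_closed:
  assumes "N \<subseteq> topspace T" "\<And>x. x \<in> N \<Longrightarrow> Pi_V T V x \<subseteq> N"
    and "\<And>p. p \<in> P \<Longrightarrow> M p \<subseteq> N \<or> M p \<inter> N = {}"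
  shows "alt_sum (betti T N) k \<le> (\<Sum>p\<in>{p\<in>P. M p \<subseteq> N}. alt_sum (betti T (M p)) k)"
  using assms
proof (induction "card N" arbitrary: N rule: less_induct)
  case less
  note NT = less.prems(1) and fwd = less.prems(2) and sat = less.prems(3)
  have finN: "finite N" using NT finite_space finite_subset by blast
  have clN: "closedin T N" by (rule forward_closed_imp_closedin[OF NT fwd])
  \<comment> \<open>No step leads into \<open>B\<close> from the rest of \<open>N\<close>; so the
    rest is closed under \<open>Pi_V\<close>, hence closed, and \<open>B\<close> is a difference of
    closed sets.\<close>
  have IH: "alt_sum (betti T N) k
      \<le> (\<Sum>p\<in>{p\<in>P. M p \<subseteq> N - B}. alt_sum (betti T (M p)) k) + alt_sum (betti T B) k"
    if B: "B \<subseteq> N" "B \<noteq> {}" and stepB: "\<And>z w. \<lbrakk>z \<in> N - B; w \<in> Pi_V T V z\<rbrakk> \<Longrightarrow> w \<notin> B"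
      and satB: "\<And>p. p \<in> P \<Longrightarrow> M p \<subseteq> N \<Longrightarrow> M p \<inter> B = {} \<or> M p \<subseteq> B" for B
  proof -
    have fwdB: "Pi_V T V z \<subseteq> N - B" if "z \<in> N - B" for z using fwd[of z] stepB that by blast
    have "closedin T (N - B)" by (rule forward_closed_imp_closedin) (use NT fwdB in auto)
    then have "alt_sum (betti T N) k \<le> alt_sum (betti T (N - B)) k + alt_sum (betti T (N - (N - B))) k"
      by (intro alt_sum_betti_Diff_closed finite_space t0 clN) auto
    moreover have "N - (N - B) = B" using B by auto
    moreover have "alt_sum (betti T (N - B)) k \<le> (\<Sum>p\<in>{p\<in>P. M p \<subseteq> N - B}. alt_sum (betti T (M p)) k)"
    proof (rule less.hyps)
      show "card (N - B) < card N" using finN B by (intro psubset_card_mono) auto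
      show "M p \<subseteq> N - B \<or> M p \<inter> (N - B) = {}" if "p \<in> P" for p
        using sat[OF that] satB[OF that] by blast
    qed (use NT fwdB in auto)
    ultimately show ?thesis by simp
  qed
  \<comment> \<open>The points that no Morse set inside \<open>N\<close> reaches. If there are any,
    a regular multivector can be removed; otherwise a maximal Morse set can.\<close>
  let ?Q = "{x\<in>N. \<forall>p\<in>P. \<forall>m\<in>M p \<inter> N. (m, x) \<notin> step\<^sup>*}"
  consider (empty) "N = {}" | (regular) "?Q \<noteq> {}" | (Morse) "N \<noteq> {}" "?Q = {}" by blast
  then show ?case
  proof cases
    case empty
    have "alt_sum (\<lambda>_. 0) k = 0" by (simp add: alt_sum_def)
    then have "alt_sum (betti T {}) k = 0" by (simp add: betti_empty[abs_def] alt_sum_def)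
    then show ?thesis using empty by (auto intro!: sum_nonneg)
  next
    case regular
    let ?r = "\<lambda>x. step\<^sup>* `` {x}"
    have fr: "finite (?r x)" for x
    proof -
      have "?r x \<subseteq> insert x (topspace T)"
        using step_topspace by (auto elim: rtranclE)
      then show ?thesis using finite_space finite_subset by blast
    qed
    have finQ: "finite ?Q" using finN by simp
    \<comment> \<open>\<open>x\<close> reaches as many points as possible. A point of another
      multivector that steps into \<open>cell V x\<close> is also in \<open>?Q\<close> and reaches
      at least as much, hence the same; so \<open>x\<close> reaches it too, which
      \<open>loop_outside_Morse_sets\<close> excludes.\<close>
    obtain x where x: "x \<in> ?Q" and Max: "Max ((\<lambda>z. card (?r z)) ` ?Q) = card (?r x)"
      by (rule obtains_MAX[OF finQ regular])
    have max: "card (?r z) \<le> card (?r x)" if "z \<in> ?Q" for z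
      unfolding Max[symmetric] by (intro Max_ge finite_imageI finQ imageI that)
    have xT: "x \<in> topspace T" using x NT by auto
    have out: "x \<notin> M p" if "p \<in> P" for p using x that by auto
    have cell: "cell V x \<subseteq> N" using fwd[of x] x by (auto simp: Pi_V_def)
    have disj: "M p \<inter> cell V x = {}" if "p \<in> P" for p
    proof (rule ccontr)
      assume "M p \<inter> cell V x \<noteq> {}"
      then obtain m where "m \<in> M p" "m \<in> cell V x" by blast
      then show False using step_cell_sym[OF xT] x that cell by blast
    qed
    have "alt_sum (betti T N) k
      \<le> (\<Sum>p\<in>{p\<in>P. M p \<subseteq> N - cell V x}. alt_sum (betti T (M p)) k) + alt_sum (betti T (cell V x)) k"
    proof (rule IH[OF cell])
      show "cell V x \<noteq> {}" using cell_in[OF xT] by blast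
      fix z w assume z: "z \<in> N - cell V x" and w: "w \<in> Pi_V T V z"
      show "w \<notin> cell V x"
      proof
        assume wc: "w \<in> cell V x"
        have "(z, w) \<in> step" using z w NT by (auto simp: step_def)
        then have zx: "(z, x) \<in> step\<^sup>*"
          using step_cell_sym[OF xT wc] by (meson converse_rtrancl_into_rtrancl r_into_rtrancl)
        have "z \<in> ?Q" using z x zx by (auto dest: rtrancl_trans)
        then have "card (?r z) \<le> card (?r x)" by (rule max)
        moreover have "?r x \<subseteq> ?r z" using zx by (auto intro: rtrancl_trans)
        ultimately have "?r x = ?r z" using fr card_subset_eq card_mono le_antisym by metis
        then have "(x, z) \<in> step\<^sup>*" by blast
        then show False using loop_outside_Morse_sets[OF xT out _ zx] z by blast
      qed
    qed (use disj in blast)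
    moreover have "{p\<in>P. M p \<subseteq> N - cell V x} = {p\<in>P. M p \<subseteq> N}" using disj by blast
    moreover have "alt_sum (betti T (cell V x)) k = 0"
      using betti_regular[OF regular_outside_Morse_sets[OF xT out]] by (simp add: alt_sum_def)
    ultimately show ?thesis by simp
  next
    case Morse
    \<comment> \<open>Empty Morse sets are left out, since removing one would not make
      \<open>N\<close> smaller.\<close>
    let ?S = "{p\<in>P. M p \<subseteq> N \<and> M p \<noteq> {}}"
    have reached: "\<exists>p\<in>?S. \<exists>m\<in>M p. (m, z) \<in> step\<^sup>*" if "z \<in> N" for z
    proof -
      obtain p m where "p \<in> P" "m \<in> M p \<inter> N" "(m, z) \<in> step\<^sup>*" using Morse(2) \<open>z \<in> N\<close> by blast
      then show ?thesis using sat[of p] by blast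
    qed
    let ?above = "\<lambda>p. {r\<in>?S. leq p r}"
    have "?S \<noteq> {}" using reached Morse(1) by blast
    \<comment> \<open>A maximal element of \<open>?S\<close>, found as one with the fewest elements
      above it.\<close>
    then obtain p where p: "p \<in> ?S" and min: "\<And>q. q \<in> ?S \<Longrightarrow> card (?above p) \<le> card (?above q)"
      using ex_has_least_nat[of "\<lambda>p. p \<in> ?S" _ "\<lambda>p. card (?above p)"] by blast
    have maximal: "q = p" if q: "q \<in> ?S" "leq p q" for q
    proof (rule ccontr)
      assume "q \<noteq> p"
      have "leq p p" using morse p by (auto simp: morse_decomposition_def)
      then have "?above q \<subset> ?above p"
        using p q \<open>q \<noteq> p\<close> leq_antisym leq_trans by blast
      moreover have "finite (?above p)" using finite_P by simp
      ultimately have "card (?above q) < card (?above p)" by (rule psubset_card_mono[rotated])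
      then show False using min[OF q(1)] by simp
    qed
    have disj: "M q \<inter> M p = {}" if "q \<in> P" "q \<noteq> p" for q using M_disjoint that p by blast
    have "alt_sum (betti T N) k
      \<le> (\<Sum>q\<in>{q\<in>P. M q \<subseteq> N - M p}. alt_sum (betti T (M q)) k) + alt_sum (betti T (M p)) k"
    proof (rule IH)
      fix z w assume z: "z \<in> N - M p" and w: "w \<in> Pi_V T V z"
      show "w \<notin> M p"
      proof
        assume wp: "w \<in> M p"
        obtain q m where q: "q \<in> ?S" and m: "m \<in> M q" "(m, z) \<in> step\<^sup>*" using reached z by blast
        have "(z, w) \<in> step\<^sup>*" using z w NT by (auto simp: step_def)
        \<comment> \<open>\<open>connecting_path\<close> leaves two cases: \<open>z\<close> lies in
          \<open>M p\<close>, or \<open>q\<close> is an element of \<open>?S\<close> strictly above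
          \<open>p\<close>. Both are excluded.\<close>
        then show False using connecting_path[of p q m w z] p q m wp z maximal by auto
      qed
    qed (use p disj in auto)
    moreover have "{q\<in>P. M q \<subseteq> N} = insert p {q\<in>P. M q \<subseteq> N - M p}"
      using p disj by blast
    moreover have "p \<notin> {q\<in>P. M q \<subseteq> N - M p}" using p by blast
    ultimately show ?thesis using finite_P by simp
  qed
qed

end

theorem theorem7p11:
  fixes T :: "'a topology" and V :: "'a set set"
    and P :: "'p set" and leq :: "'p \<Rightarrow> 'p \<Rightarrow> bool" and M :: "'p \<Rightarrow> 'a set"
  assumes "finite (topspace T)" and "t0_space T"
    and "mvfield T V"
    and "invariant T V (topspace T)"
    and "morse_decomposition T V P leq M"
  shows "\<forall>k::nat.
     (\<Sum>j\<le>k. (-1::int) ^ (k - j) * int (morse_number T P M j))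
       \<ge> (\<Sum>j\<le>k. (-1::int) ^ (k - j) * int (betti T (topspace T) j))
     \<and> morse_number T P M k \<ge> betti T (topspace T) k"
proof -
  interpret morse_space T V P leq M
    by unfold_locales (use assms in auto)
  have strong: "alt_sum (betti T (topspace T)) k \<le> alt_sum (morse_number T P M) k" for k
  proof -
    have "alt_sum (betti T (topspace T)) k \<le> (\<Sum>p\<in>{p\<in>P. M p \<subseteq> topspace T}. alt_sum (betti T (M p)) k)"
      by (rule alt_sum_betti_forward_closed) (use Pi_V_subset M_subset in auto)
    also have "{p\<in>P. M p \<subseteq> topspace T} = P" using M_subset by blast
    also have "(\<Sum>p\<in>P. alt_sum (betti T (M p)) k) = alt_sum (morse_number T P M) k"
      unfolding alt_sum_def morse_number_def
      by (subst sum.swap) (simp add: sum_distrib_left)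
    finally show ?thesis .
  qed
  \<comment> \<open>In degree \<open>Suc j\<close> this is the sum of the strong inequalities for
    \<open>j\<close> and \<open>Suc j\<close>.\<close>
  moreover have "betti T (topspace T) k \<le> morse_number T P M k" for k
  proof (cases k)
    case 0
    then show ?thesis using strong[of 0] by simp
  next
    case (Suc j)
    then show ?thesis using strong[of j] strong[of "Suc j"] by simp
  qed
  ultimately show ?thesis by (simp add: alt_sum_def)
qed

end
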